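(* Let $(\mathfrak X,d)$ be a separable and complete CC space, let $\varphi:\mathfrak X\to\mathbb R$ be a midpoint convex and continuous function, let $\mathcal G\subset\mathcal F$ be a sub-$\sigma$-algebra, and let $X$ be an integrable $\mathfrak X$-valued random element such that $\varphi(X)$ is an integrable real random variable. Then $\varphi(E(X|\mathcal G))\le E(\varphi(X)|\mathcal G)$ a.s.
   Context: A convex combination space (CC space) is a metric space $(\mathfrak X,d)$ endowed with a convex combination operation, which to all $n\ge1$, all $\lambda_1,\dots,\lambda_n>0$ with $\sum_{i=1}^n\lambda_i=1$ and all $u_1,\dots,u_n\in\mathfrak X$ assigns an element $[\lambda_1,u_1;\dots;\lambda_n,u_n]=[\lambda_i,u_i]_{i=1}^n$ of $\mathfrak X$, with $[1,u]=u$, and such that: (CC.i) $[\lambda_i,u_i]_{i=1}^n=[\lambda_{\sigma(i)},u_{\sigma(i)}]_{i=1}^n$ for every permutation $\sigma$ of $\{1,\dots,n\}$; (CC.ii) $[\lambda_i,u_i]_{i=1}^{n+2}=\big[\lambda_1,u_1;\dots;\lambda_n,u_n;\lambda_{n+1}+\lambda_{n+2},\big[\tfrac{\lambda_{n+j}}{\lambda_{n+1}+\lambda_{n+2}},u_{n+j}\big]_{j=1}^2\big]$; (CC.iii) if $u,v\in\mathfrak X$ and $\lambda^{(k)}\to\lambda\in(0,1)$ then $[\lambda^{(k)},u;1-\lambda^{(k)},v]\to[\lambda,u;1-\lambda,v]$; (CC.iv) for $u_1,u_2,v_1,v_2\in\mathfrak X$ and $\lambda\in(0,1)$, $d([\lambda,u_1;1-\lambda,u_2],[\lambda,v_1;1-\lambda,v_2])\le\lambda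 d(u_1,v_1)+(1-\lambda)d(u_2,v_2)$; (CC.v) for each $u\in\mathfrak X$ the limit $Ku:=\lim_{n\to\infty}[n^{-1},u]_{i=1}^n$ exists in $\mathfrak X$; $K$ is called the convexification operator. Write $K(\mathfrak X)=\{Ku:u\in\mathfrak X\}$; $K$ is idempotent. For points of $K(\mathfrak X)$, weights in $[0,1]$ are allowed by discarding entries with weight $0$. A map $\varphi:\mathfrak X\to\mathbb R$ is midpoint convex if $\varphi([1/2,x;1/2,y])\le(\varphi(x)+\varphi(y))/2$ for all $x,y\in\mathfrak X$. $(\Omega,\mathcal F,P)$ is a complete probability space without atoms. A random element is a map $X:\Omega\to\mathfrak X$ measurable with respect to $\mathcal F$ and the Borel $\sigma$-algebra; it is integrable if $d(u,X)$ is integrable for some (equivalently every) $u\in\mathfrak X$. A simple random element takes finitely many values; if $X=x_i$ on $\Omega_i$, where $\Omega_1,\dots,\Omega_n$ is a measurable partition of $\Omega$, write $X=[I_{\Omega_i},x_i]_{i=1}^n$ and define, for a sub-$\sigma$-algebra $\mathcal G\subset\mathcal F$, $E(X|\mathcal G)=[E(I_{\Omega_i}|\mathcal G),Kx_i]_{i=1}^n$. For integrable $X$: fix $u_0\in K(\mathfrak X)$ and a countable dense set $\{u_j:j\ge1\}\subset\mathfrak X$, let $\psi_n(x)=u_{m_n(x)}$, where $m_n(x)$ is the smallest $i\in\{0,\dots,n\}$ with $d(u_i,x)=\min_{0\le j\le n}d(u_j,x)$, and define the conditional expectation $E(X|\mathcal G)=\lim_{n\to\infty}E(\psi_n(X)|\mathcal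 G)$ a.s. (up to a null set); the limit exists and is an integrable, $\mathcal G$-measurable, $K(\mathfrak X)$-valued random element. *)

theory Defs
  imports "HOL-Probability.Probability" "HOL-Combinatorics.Permutations"
begin

(* A convex combination [l1, u1; ...; ln, un] is cc applied to the list [(l1, u1), ..., (ln, un)].
   Only lists satisfying convex_weights are meaningful; cc is unconstrained on all others. *)
definition convex_weights :: "(real \<times> 'x) list \<Rightarrow> bool" where
  "convex_weights ws \<longleftrightarrow> (\<forall>w\<in>set ws. fst w > 0) \<and> sum_list (map fst ws) = 1"

locale cc_space =
  fixes cc :: "(real \<times> 'x::metric_space) list \<Rightarrow> 'x"
  assumes cc_single: "cc [(1, u)] = u"
    and cc_permute: "convex_weights ws \<Longrightarrow> \<sigma> permutes {..<length ws} \<Longrightarrow>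
      cc (permute_list \<sigma> ws) = cc ws"
    and cc_merge: "convex_weights (ws @ [(a, u), (b, v)]) \<Longrightarrow>
      cc (ws @ [(a, u), (b, v)]) = cc (ws @ [(a + b, cc [(a / (a + b), u), (b / (a + b), v)])])"
    and cc_continuous_weights: "(\<And>k. 0 < l k \<and> l k < 1) \<Longrightarrow> l \<longlonglongrightarrow> l0 \<Longrightarrow> 0 < l0 \<Longrightarrow> l0 < 1 \<Longrightarrow>
      (\<lambda>k::nat. cc [(l k, u), (1 - l k, v)]) \<longlonglongrightarrow> cc [(l0, u), (1 - l0, v)]"
    and cc_dist_le: "0 < t \<Longrightarrow> t < 1 \<Longrightarrow>
      dist (cc [(t, u1), (1 - t, u2)]) (cc [(t, v1), (1 - t, v2)]) \<le> t * dist u1 v1 + (1 - t) * dist u2 v2"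
    and cc_convexification_convergent: "convergent (\<lambda>n. cc (replicate n (1 / real n, u)))"

definition convexification :: "((real \<times> 'x::metric_space) list \<Rightarrow> 'x) \<Rightarrow> 'x \<Rightarrow> 'x" where
  "convexification cc u = lim (\<lambda>n. cc (replicate n (1 / real n, u)))"

definition midpoint_convex :: "((real \<times> 'x) list \<Rightarrow> 'x) \<Rightarrow> ('x \<Rightarrow> real) \<Rightarrow> bool" where
  "midpoint_convex cc \<phi> \<longleftrightarrow> (\<forall>x y. \<phi> (cc [(1/2, x), (1/2, y)]) \<le> (\<phi> x + \<phi> y) / 2)"

definition atomless :: "'a measure \<Rightarrow> bool" where
  "atomless M \<longleftrightarrow> (\<forall>A\<in>sets M. emeasure M A > 0 \<longrightarrow>
     (\<exists>B\<in>sets M. B \<subseteq> A \<and> 0 < emeasure M B \<and> emeasure M B < emeasure M A))"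

definition integrable_element :: "'a measure \<Rightarrow> ('a \<Rightarrow> 'x::metric_space) \<Rightarrow> bool" where
  "integrable_element M X \<longleftrightarrow> X \<in> borel_measurable M \<and> (\<exists>u. integrable M (\<lambda>\<omega>. dist u (X \<omega>)))"

(* S = [I_(A1), x1; ...; I_(An), xn] for ws = [(A1, x1), ..., (An, xn)], where A1, ..., An is a
   measurable partition; some of the A's may be empty and the x's need not be distinct. *)
definition simple_representation :: "'a measure \<Rightarrow> ('a \<Rightarrow> 'x) \<Rightarrow> ('a set \<times> 'x) list \<Rightarrow> bool" where
  "simple_representation M S ws \<longleftrightarrow>
     (\<forall>(A, x)\<in>set ws. A \<in> sets M \<and> (\<forall>\<omega>\<in>A. S \<omega> = x)) \<and>
     disjoint_family_on (\<lambda>i. fst (ws ! i)) {..<length ws} \<and>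
     (\<Union>i<length ws. fst (ws ! i)) = space M"

(* Outside a null set the weights lie in [0, 1] and add up to 1, and those equal to 0 are discarded;
   up to a null set the result depends neither on the chosen representation nor on the versions
   of the conditional probabilities. *)
definition simple_cond_exp ::
  "((real \<times> 'x::metric_space) list \<Rightarrow> 'x) \<Rightarrow> 'a measure \<Rightarrow> 'a measure \<Rightarrow> ('a \<Rightarrow> 'x) \<Rightarrow> 'a \<Rightarrow> 'x" where
  "simple_cond_exp cc M G S \<omega> =
     cc (filter (\<lambda>w. fst w \<noteq> 0)
       (map (\<lambda>(A, x). (real_cond_exp M G (indicator A) \<omega>, convexification cc x))
         (SOME ws. simple_representation M S ws)))"

definition nearest_point :: "(nat \<Rightarrow> 'x::metric_space) \<Rightarrow> nat \<Rightarrow> 'x \<Rightarrow> 'x" where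
  "nearest_point u n x =
     u (LEAST i. i \<le> n \<and> dist (u i) x = Min ((\<lambda>j. dist (u j) x) ` {0..n}))"

(* The admissible choices of the point u 0 and of the dense set {u j | j >= 1}. *)
definition approximating_sequence ::
  "((real \<times> 'x::metric_space) list \<Rightarrow> 'x) \<Rightarrow> (nat \<Rightarrow> 'x) \<Rightarrow> bool" where
  "approximating_sequence cc u \<longleftrightarrow> u 0 \<in> range (convexification cc) \<and> closure (u ` {1..}) = UNIV"

(* One version of the conditional expectation, for the choice u of approximating sequence; its value
   is unspecified on the null set where the limit does not exist. *)
definition cc_cond_exp ::
  "((real \<times> 'x::metric_space) list \<Rightarrow> 'x) \<Rightarrow> (nat \<Rightarrow> 'x) \<Rightarrow> 'a measure \<Rightarrow> 'a measure \<Rightarrow>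
   ('a \<Rightarrow> 'x) \<Rightarrow> 'a \<Rightarrow> 'x" where
  "cc_cond_exp cc u M G X \<omega> =
     lim (\<lambda>n. simple_cond_exp cc M G (\<lambda>\<omega>'. nearest_point u n (X \<omega>')) \<omega>)"

end

theory Submission
  imports Defs
begin

text \<open>
  On the points of \<open>K(X)\<close>, where \<open>[t, z; 1 - t, z] = z\<close>, a continuous midpoint convex \<open>\<phi>\<close> is convex, and
  \<open>\<phi>(K x) \<le> \<phi>(x)\<close> because \<open>[2\<^sup>-\<^sup>n, x]\<close> arises from \<open>x\<close> by iterated midpoints. This gives the inequality
  for simple random elements. Passing to a common refinement of two partitions, one gets
  \<open>d(E(S|G), E(T|G)) \<le> E(d(S,T)|G)\<close> a.s. for simple \<open>S\<close>, \<open>T\<close>. Hence the defining sequence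
  \<open>E(\<psi>\<^sub>n(X)|G)\<close> is a.s. Cauchy, since \<open>d(\<psi>\<^sub>n(X), X)\<close> decreases to 0, and \<open>E(X|G)\<close> is also the a.s. limit of
  \<open>E(Z\<^sub>k|G)\<close> along any sufficiently fast sequence of simple \<open>Z\<^sub>k\<close> with \<open>Z\<^sub>k \<rightarrow> X\<close> in \<open>L\<^sup>1\<close>. Choosing
  \<open>Z\<^sub>k\<close> such that also \<open>\<phi>(Z\<^sub>k) \<rightarrow> \<phi>(X)\<close> in \<open>L\<^sup>1\<close>, the inequality passes to the limit.
\<close>

section \<open>Convex combinations of multisets\<close>

definition convex_mset :: "(real \<times> 'x) multiset \<Rightarrow> bool" where
  "convex_mset N \<longleftrightarrow> (\<forall>w\<in>#N. 0 \<le> fst w) \<and> (\<Sum>w\<in>#N. fst w) = 1"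

definition scale_mset :: "real \<Rightarrow> (real \<times> 'x) multiset \<Rightarrow> (real \<times> 'x) multiset" where
  "scale_mset c N = image_mset (\<lambda>w. (c * fst w, snd w)) N"

lemma scale_mset_simps [simp]:
  "scale_mset c {#} = {#}"
  "scale_mset c (add_mset w N) = add_mset (c * fst w, snd w) (scale_mset c N)"
  "scale_mset c (N + W) = scale_mset c N + scale_mset c W"
  by (simp_all add: scale_mset_def)

lemma scale_mset_scale_mset [simp]: "scale_mset c (scale_mset d N) = scale_mset (c * d) N"
  by (simp add: scale_mset_def multiset.map_comp o_def mult.assoc)

lemma scale_mset_1 [simp]: "scale_mset 1 N = N"
  by (simp add: scale_mset_def)

lemma sum_scale_mset [simp]: "(\<Sum>w\<in>#scale_mset c N. fst w) = c * (\<Sum>w\<in>#N. fst w)"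
  by (simp add: scale_mset_def multiset.map_comp o_def sum_mset_distrib_left)

lemma scale_mset_nonneg: "0 \<le> c \<Longrightarrow> \<forall>w\<in>#N. 0 \<le> fst w \<Longrightarrow> \<forall>w\<in>#scale_mset c N. 0 \<le> fst w"
  by (auto simp: scale_mset_def)

lemma sum_mset_filter_nonzero:
  "(\<Sum>w\<in>#filter_mset (\<lambda>w. fst w \<noteq> 0) N. fst w) = (\<Sum>w\<in>#N. fst w :: real)"
  by (induction N) auto

lemma convex_mset_mix:
  assumes "convex_mset N" "convex_mset W" "0 \<le> t" "t \<le> 1"
  shows "convex_mset (scale_mset t N + scale_mset (1 - t) W)"
proof -
  have "\<forall>w\<in>#scale_mset t N. 0 \<le> fst w" "\<forall>w\<in>#scale_mset (1 - t) W. 0 \<le> fst w"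
    using assms by (auto simp: scale_mset_def convex_mset_def)
  then show ?thesis using assms by (simp add: convex_mset_def ball_Un)
qed

lemma sum_list_pos:
  fixes xs :: "real list"
  assumes "xs \<noteq> []" "\<forall>x\<in>set xs. 0 < x"
  shows "0 < sum_list xs"
  using assms
proof (induction xs)
  case (Cons x xs)
  have "0 \<le> sum_list xs"
    using Cons.prems by (intro sum_list_nonneg) (auto simp: less_imp_le)
  then show ?case using Cons.prems by simp
qed simp

section \<open>Regrouping the entries of a convex combination\<close>

context cc_space
begin

lemma cc_cong_mset:
  assumes "convex_weights ws" "mset ws = mset ws'"
  shows "cc ws = cc ws'"
proof -
  obtain \<sigma> where s: "\<sigma> permutes {..<length ws}" "permute_list \<sigma> ws = ws'"
    using mset_eq_permutation[of ws' ws] assms(2) by auto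
  show ?thesis using cc_permute[OF assms(1) s(1)] s(2) by simp
qed

text \<open>Merging the last two entries by (CC.ii) shortens the block \<open>ws\<close> by one, so
  the induction hypothesis applies to the shorter block. The same merge, carried out inside the
  normalised block, shows that the inner combination has not changed.\<close>

lemma cc_group:
  assumes "ws \<noteq> []" "convex_weights (vs @ ws)"
  shows "cc (vs @ ws) = cc (vs @ [(sum_list (map fst ws),
           cc (map (\<lambda>w. (fst w / sum_list (map fst ws), snd w)) ws))])"
  using assms
proof (induction "length ws" arbitrary: ws rule: less_induct)
  case less
  have pos: "\<forall>w\<in>set ws. 0 < fst w" using less.prems by (auto simp: convex_weights_def)
  define s where "s = sum_list (map fst ws)"
  have s: "s > 0" unfolding s_def using less.prems pos by (intro sum_list_pos) auto
  show ?case
  proof (cases "length ws = 1")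
    case True
    then obtain a u where ws: "ws = [(a, u)]" by (cases ws) auto
    then show ?thesis using s by (simp add: s_def cc_single)
  next
    case False
    obtain ws1 w2 where ws1: "ws = ws1 @ [w2]"
      using less.prems(1) by (metis rev_exhaust)
    with False obtain ws0 w1 where ws2: "ws1 = ws0 @ [w1]"
      by (cases ws1 rule: rev_cases) auto
    obtain a u b v where w: "w1 = (a, u)" "w2 = (b, v)" by fastforce
    have ws: "ws = ws0 @ [(a, u), (b, v)]" using ws1 ws2 w by simp
    have ab: "a > 0" "b > 0" using pos ws by auto
    define m where "m = cc [(a / (a + b), u), (b / (a + b), v)]"
    define ws' where "ws' = ws0 @ [(a + b, m)]"
    have s': "sum_list (map fst ws') = s" by (simp add: s_def ws ws'_def)
    have cw': "convex_weights (vs @ ws')"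
      using less.prems(2) ab by (auto simp: convex_weights_def ws ws'_def)
    have cwm: "convex_weights (map (\<lambda>w. (fst w / s, snd w)) ws)"
    proof -
      have "(\<Sum>w\<leftarrow>ws. fst w / s) = s / s"
        unfolding s_def divide_inverse sum_list_mult_const ..
      then show ?thesis using pos s by (simp add: convex_weights_def o_def)
    qed
    have "cc (vs @ ws) = cc (vs @ ws')"
      using cc_merge[of "vs @ ws0" a u b v] less.prems(2) by (simp add: ws ws'_def m_def)
    also have "\<dots> = cc (vs @ [(s, cc (map (\<lambda>w. (fst w / s, snd w)) ws'))])"
      using less.hyps[of ws'] cw' s' by (simp add: ws ws'_def)
    also have "cc (map (\<lambda>w. (fst w / s, snd w)) ws') = cc (map (\<lambda>w. (fst w / s, snd w)) ws)"
    proof -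
      \<comment> \<open>Division by \<open>s\<close> preserves the relative weights of the merged
        pair, so the same point \<open>m\<close> serves before and after normalisation.\<close>
      have "a / s + b / s = (a + b) / s" by (simp add: add_divide_distrib)
      moreover have "a / s / ((a + b) / s) = a / (a + b)" "b / s / ((a + b) / s) = b / (a + b)"
        using s by auto
      ultimately show ?thesis
        using s cc_merge[of "map (\<lambda>w. (fst w / s, snd w)) ws0" "a / s" u "b / s" v] cwm
        by (simp add: ws ws'_def m_def)
    qed
    finally show ?thesis by (simp add: s_def)
  qed
qed

text \<open>The listing picked by \<open>SOME\<close> is immaterial for convex weights, by
  \<open>cc_cong_mset\<close>. Zero weights are removed in the same way as in
  \<open>simple_cond_exp\<close>.\<close>

definition bar :: "(real \<times> 'x) multiset \<Rightarrow> 'x" where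
  "bar N = cc (SOME ws. mset ws = filter_mset (\<lambda>w. fst w \<noteq> 0) N)"

lemma bar_mset:
  assumes "convex_mset (mset ws)"
  shows "bar (mset ws) = cc (filter (\<lambda>w. fst w \<noteq> 0) ws)"
proof -
  let ?ws' = "filter (\<lambda>w. fst w \<noteq> 0) ws"
  have "mset (SOME ws''. mset ws'' = filter_mset (\<lambda>w. fst w \<noteq> 0) (mset ws)) = mset ?ws'"
    using someI[of "\<lambda>ws''. mset ws'' = filter_mset (\<lambda>w. fst w \<noteq> 0) (mset ws)" ?ws'] by simp
  moreover have "convex_weights ?ws'"
    using assms sum_mset_filter_nonzero[of "mset ws"] unfolding convex_weights_def convex_mset_def
    by (auto simp: less_le simp flip: sum_mset_sum_list)
  ultimately show ?thesis unfolding bar_def using cc_cong_mset by metis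
qed

lemma bar_zero [simp]: "bar (add_mset (0, u) N) = bar N"
  by (simp add: bar_def)

lemma bar_single [simp]: "bar {#(1, u)#} = u"
  using bar_mset[of "[(1, u)]"] by (simp add: convex_mset_def cc_single)

lemma bar_pair:
  assumes "0 < t" "t < 1"
  shows "bar {#(t, u), (1 - t, v)#} = cc [(t, u), (1 - t, v)]"
  using bar_mset[of "[(t, u), (1 - t, v)]"] assms by (simp add: convex_mset_def)

lemma bar_filter: "bar (filter_mset (\<lambda>w. fst w \<noteq> 0) N) = bar N"
  by (simp add: bar_def filter_filter_mset)

text \<open>This reduces to \<open>cc_group\<close> once zero weights are discarded;
  \<open>s > 0\<close> ensures that the block \<open>W\<close> does not become empty in the
  process.\<close>

lemma bar_group:
  assumes "convex_mset (N + W)" "s = (\<Sum>w\<in>#W. fst w)" "s > 0"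
  shows "bar (N + W) = bar (add_mset (s, bar (scale_mset (1 / s) W)) N)"
proof -
  obtain vs where vs: "mset vs = filter_mset (\<lambda>w. fst w \<noteq> 0) N" using ex_mset by blast
  obtain ws where ws: "mset ws = filter_mset (\<lambda>w. fst w \<noteq> 0) W" using ex_mset by blast
  have nz: "\<forall>w\<in>set (vs @ ws). fst w \<noteq> 0"
  proof -
    have "\<forall>w\<in>#mset vs + mset ws. fst w \<noteq> 0" unfolding vs ws by auto
    then show ?thesis by auto
  qed
  have "filter_mset (\<lambda>w. fst w \<noteq> 0) (N + W) = mset (vs @ ws)"
    using vs ws by simp
  moreover have cm: "convex_mset (mset (vs @ ws))"
    using assms(1) sum_mset_filter_nonzero[of "N + W"] vs ws
    by (auto simp: convex_mset_def simp flip: set_mset_mset)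
  ultimately have 1: "bar (N + W) = bar (mset (vs @ ws))" by (metis bar_filter)
  have 2: "bar (mset (vs @ ws)) = cc (vs @ ws)"
    using bar_mset[OF cm] nz by (simp add: filter_id_conv[THEN iffD2])
  have cw: "convex_weights (vs @ ws)"
    using cm nz unfolding convex_weights_def convex_mset_def
    by (auto simp: less_le simp flip: sum_mset_sum_list)
  have s: "s = sum_list (map fst ws)"
    using assms(2) sum_mset_filter_nonzero[of W] ws by (metis mset_map sum_mset_sum_list)
  then have "ws \<noteq> []" using assms(3) by auto
  note 3 = cc_group[OF this cw, folded s]
  have cs: "convex_mset (scale_mset (1 / s) (mset ws))"
    using cm assms(3) s scale_mset_nonneg[of "1 / s" "mset ws"]
    by (auto simp: convex_mset_def sum_mset_sum_list[symmetric])
  have sm: "scale_mset (1 / s) (mset ws) = mset (map (\<lambda>w. (fst w / s, snd w)) ws)"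
    by (simp add: scale_mset_def)
  have f: "filter_mset (\<lambda>w. fst w \<noteq> 0) (scale_mset (1 / s) W) = scale_mset (1 / s) (mset ws)"
    unfolding ws using assms(3) by (induction W) auto
  have "bar (scale_mset (1 / s) W) = bar (scale_mset (1 / s) (mset ws))"
    using f bar_filter by metis
  also have "\<dots> = cc (map (\<lambda>w. (fst w / s, snd w)) ws)"
    using bar_mset[of "map (\<lambda>w. (fst w / s, snd w)) ws"] cs sm nz assms(3)
    by (simp add: filter_map o_def filter_id_conv[THEN iffD2])
  finally have 4: "bar (scale_mset (1 / s) W) = cc (map (\<lambda>w. (fst w / s, snd w)) ws)" .
  let ?y = "bar (scale_mset (1 / s) W)"
  have cm5: "convex_mset (mset (vs @ [(s, ?y)]))"
    using cm s assms(3) by (auto simp: convex_mset_def sum_mset_sum_list[symmetric])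
  have "bar (add_mset (s, ?y) N) = bar (mset (vs @ [(s, ?y)]))"
    using bar_filter[of "add_mset (s, ?y) N"] vs assms(3) by simp
  also have "\<dots> = cc (vs @ [(s, ?y)])"
    using bar_mset[OF cm5] nz assms(3) by (simp add: filter_id_conv[THEN iffD2])
  finally show ?thesis using 1 2 3 4 by simp
qed

text \<open>Two uses of \<open>bar_group\<close>: the block of total weight \<open>1 - t\<close> is
  collapsed first, then the block of weight \<open>t\<close>.\<close>

lemma bar_mix:
  assumes "convex_mset N" "convex_mset W" "0 < t" "t < 1"
  shows "bar (scale_mset t N + scale_mset (1 - t) W) = bar {#(t, bar N), (1 - t, bar W)#}"
proof -
  have "bar (scale_mset t N + scale_mset (1 - t) W) = bar (add_mset (1 - t, bar W) (scale_mset t N))"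
    using bar_group[OF convex_mset_mix[OF assms(1,2)], of t "1 - t"] assms
    by (simp add: convex_mset_def)
  also have "\<dots> = bar ({#(1 - t, bar W)#} + scale_mset t N)" by simp
  also have "\<dots> = bar {#(t, bar N), (1 - t, bar W)#}"
  proof -
    have "\<forall>w\<in>#scale_mset t N. 0 \<le> fst w"
      using assms by (auto simp: scale_mset_def convex_mset_def)
    then have "convex_mset ({#(1 - t, bar W)#} + scale_mset t N)"
      using assms by (simp add: convex_mset_def)
    from bar_group[OF this, of t] show ?thesis using assms by (simp add: convex_mset_def)
  qed
  finally show ?thesis .
qed

section \<open>Points that are unchanged when their weight is split\<close>

definition convex_point :: "'x \<Rightarrow> bool" where
  "convex_point z \<longleftrightarrow> (\<forall>t. 0 < t \<longrightarrow> t < 1 \<longrightarrow> cc [(t, z), (1 - t, z)] = z)"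

text \<open>Collapsing the two copies of \<open>u\<close> by \<open>bar_group\<close> yields a
  two-point combination of \<open>u\<close> with itself, which for a general \<open>u\<close> may
  differ from \<open>u\<close>. Convex points are those for which it does not; by
  \<open>convex_point_convexification\<close> all points of K(X) are of this kind.\<close>

lemma bar_merge:
  assumes "convex_point u" "convex_mset (N + {#(a, u), (b, u)#})"
  shows "bar (N + {#(a, u), (b, u)#}) = bar (N + {#(a + b, u)#})"
proof (cases "a = 0 \<or> b = 0")
  case False
  then have ab: "0 < a" "0 < b" using assms(2) by (auto simp: convex_mset_def less_le)
  have "1 - a / (a + b) = b / (a + b)" using ab by (simp add: field_simps)
  moreover have "bar {#(a / (a + b), u), (1 - a / (a + b), u)#} = u"
    using ab assms(1) by (subst bar_pair) (auto simp: convex_point_def)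
  ultimately show ?thesis
    using bar_group[OF assms(2), of "a + b"] ab by simp
qed (auto simp: add_mset_commute)

text \<open>Mixing the combination with itself gives two copies of \<open>x\<close> and two of
  \<open>y\<close>. Merging equal points, first \<open>x\<close> and then \<open>y\<close>, restores
  the weights \<open>s\<close> and \<open>1 - s\<close>.\<close>

lemma convex_point_bar_pair:
  assumes "convex_point x" "convex_point y" "0 \<le> s" "s \<le> 1"
  shows "convex_point (bar {#(s, x), (1 - s, y)#})"
  unfolding convex_point_def
proof (intro allI impI)
  fix t :: real assume t: "0 < t" "t < 1"
  let ?N = "{#(s, x), (1 - s, y)#}"
  have c: "convex_mset ?N" using assms by (simp add: convex_mset_def)
  have c2: "convex_mset ({#(t * (1 - s), y), ((1 - t) * (1 - s), y)#} + {#(t * s, x), ((1 - t) * s, x)#})"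
    using assms t by (simp add: convex_mset_def) (simp add: algebra_simps)
  have c3: "convex_mset ({#(s, x)#} + {#(t * (1 - s), y), ((1 - t) * (1 - s), y)#})"
    using assms t by (simp add: convex_mset_def) (simp add: algebra_simps)
  have "cc [(t, bar ?N), (1 - t, bar ?N)] = bar (scale_mset t ?N + scale_mset (1 - t) ?N)"
    using bar_mix[OF c c t] bar_pair[OF t] by simp
  also have "\<dots> = bar ({#(t * (1 - s), y), ((1 - t) * (1 - s), y)#} + {#(t * s, x), ((1 - t) * s, x)#})"
    by (simp add: add_mset_commute)
  also have "\<dots> = bar ({#(s, x)#} + {#(t * (1 - s), y), ((1 - t) * (1 - s), y)#})"
    by (subst bar_merge[OF assms(1) c2]) (simp add: algebra_simps add_mset_commute)
  also have "\<dots> = bar ({#(s, x)#} + {#(t * (1 - s) + (1 - t) * (1 - s), y)#})"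
    by (rule bar_merge[OF assms(2) c3])
  also have "t * (1 - s) + (1 - t) * (1 - s) = 1 - s" by (simp add: algebra_simps)
  finally show "cc [(t, bar ?N), (1 - t, bar ?N)] = bar ?N" by (simp add: add_mset_commute)
qed

section \<open>Barycentres of families over a finite index set\<close>

definition bary :: "'i set \<Rightarrow> ('i \<Rightarrow> real) \<Rightarrow> ('i \<Rightarrow> 'x) \<Rightarrow> 'x" where
  "bary I p x = bar (image_mset (\<lambda>i. (p i, x i)) (mset_set I))"

lemma bary_cong:
  "(\<And>i. i \<in> I \<Longrightarrow> p i = q i) \<Longrightarrow> (\<And>i. i \<in> I \<Longrightarrow> x i = y i) \<Longrightarrow> bary I p x = bary I q y"
  unfolding bary_def
  by (rule arg_cong[where f = bar], cases "finite I") (auto intro!: image_mset_cong)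

lemma bar_zeros:
  assumes "finite I" "\<And>i. i \<in> I \<Longrightarrow> p i = 0"
  shows "bar (N + image_mset (\<lambda>i. (p i, x i)) (mset_set I)) = bar N"
  using assms by (induction I rule: finite_induct) auto

lemma sum_bary_mset:
  "finite I \<Longrightarrow> (\<Sum>w\<in>#image_mset (\<lambda>i. (p i, x i)) (mset_set I). fst w) = sum p I"
  by (simp add: multiset.map_comp o_def sum_unfold_sum_mset)

lemma convex_mset_bary:
  assumes "finite I" "\<And>i. i \<in> I \<Longrightarrow> 0 \<le> p i" "sum p I = 1"
  shows "convex_mset (image_mset (\<lambda>i. (p i, x i)) (mset_set I))"
  using assms sum_bary_mset[of I p x] by (auto simp: convex_mset_def)

lemma bary_insert_0:
  assumes "finite I" "i \<notin> I" "p i = 0"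
  shows "bary (insert i I) p x = bary I p x"
  using assms by (simp add: bary_def)

lemma bary_insert_1:
  assumes "finite I" "i \<notin> I" "p i = 1" "\<And>j. j \<in> I \<Longrightarrow> 0 \<le> p j" "sum p (insert i I) = 1"
  shows "bary (insert i I) p x = x i"
proof -
  have "sum p I = 0" using assms by simp
  then have "\<And>j. j \<in> I \<Longrightarrow> p j = 0" using assms by (simp add: sum_nonneg_eq_0_iff)
  then show ?thesis
    using bar_zeros[of I p "{#(1, x i)#}" x] assms by (simp add: bary_def)
qed

text \<open>The family is a mixture of the single entry \<open>x i\<close> and the renormalised
  rest, so \<open>bar_mix\<close> applies. This is the recursion behind the inductions on the index
  set below; the weights 0 and 1 are covered by \<open>bary_insert_0\<close> and
  \<open>bary_insert_1\<close>.\<close>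

lemma bary_insert:
  assumes "finite I" "i \<notin> I" "0 < p i" "p i < 1" "\<And>j. j \<in> I \<Longrightarrow> 0 \<le> p j" "sum p (insert i I) = 1"
  shows "bary (insert i I) p x = cc [(p i, x i), (1 - p i, bary I (\<lambda>j. p j / (1 - p i)) x)]"
proof -
  let ?N = "image_mset (\<lambda>j. (p j / (1 - p i), x j)) (mset_set I)"
  have s: "sum p I = 1 - p i" using assms by simp
  have N: "convex_mset ?N"
    using assms s by (intro convex_mset_bary) (auto simp flip: sum_divide_distrib)
  have "scale_mset (1 - p i) ?N = image_mset (\<lambda>j. (p j, x j)) (mset_set I)"
    using assms(4) by (simp add: scale_mset_def multiset.map_comp o_def)
  then show ?thesis
    using bar_mix[OF _ N assms(3,4), of "{#(1, x i)#}"] assms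
    by (simp add: bary_def bar_pair convex_mset_def)
qed


lemma convex_point_bary:
  assumes "finite I" "\<And>i. i \<in> I \<Longrightarrow> 0 \<le> p i" "sum p I = 1"
    and "\<And>i. i \<in> I \<Longrightarrow> convex_point (x i)"
  shows "convex_point (bary I p x)"
  using assms
proof (induction I arbitrary: p rule: finite_induct)
  case (insert i I)
  have "0 \<le> sum p I" using insert by (intro sum_nonneg) auto
  then have "p i \<le> 1" using insert by simp
  then consider "p i = 0" | "p i = 1" | "0 < p i" "p i < 1"
    using insert.prems(1)[of i] by fastforce
  then show ?case
  proof cases
    case 1
    then show ?thesis using insert by (simp add: bary_insert_0)
  next
    case 2
    then show ?thesis using insert by (simp add: bary_insert_1)
  next
    case 3
    have "convex_point (bary I (\<lambda>j. p j / (1 - p i)) x)"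
      using insert 3 by (intro insert.IH) (auto simp flip: sum_divide_distrib)
    then show ?thesis
      using insert 3 convex_point_bar_pair[of "x i" _ "p i"] bary_insert[of I i p x]
      by (simp add: bar_pair)
  qed
qed simp

text \<open>Induction from the two-point case (CC.iv): the factor \<open>1 - p i\<close> in front of
  the remainder cancels the renormalisation in the induction hypothesis. A common index set lets two
  families with equal weights be compared entry by entry.\<close>

lemma dist_bary_le:
  assumes "finite I" "\<And>i. i \<in> I \<Longrightarrow> 0 \<le> p i" "sum p I = 1"
  shows "dist (bary I p x) (bary I p y) \<le> (\<Sum>i\<in>I. p i * dist (x i) (y i))"
  using assms
proof (induction I arbitrary: p rule: finite_induct)
  case (insert i I)
  have nn: "0 \<le> sum p I" "0 \<le> (\<Sum>j\<in>I. p j * dist (x j) (y j))"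
    using insert by (intro sum_nonneg; auto)+
  then have "p i \<le> 1" using insert by simp
  then consider "p i = 0" | "p i = 1" | "0 < p i" "p i < 1"
    using insert.prems(1)[of i] by fastforce
  then show ?case
  proof cases
    case 1
    then show ?thesis using insert by (simp add: bary_insert_0)
  next
    case 2
    then show ?thesis using insert nn by (simp add: bary_insert_1)
  next
    case 3
    let ?q = "\<lambda>j. p j / (1 - p i)"
    have "dist (bary I ?q x) (bary I ?q y) \<le> (\<Sum>j\<in>I. ?q j * dist (x j) (y j))"
      using insert 3 by (intro insert.IH) (auto simp flip: sum_divide_distrib)
    also have "\<dots> = (\<Sum>j\<in>I. p j * dist (x j) (y j)) / (1 - p i)"
      by (simp add: sum_divide_distrib)
    finally have "(1 - p i) * dist (bary I ?q x) (bary I ?q y) \<le> (\<Sum>j\<in>I. p j * dist (x j) (y j))"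
      using 3 by (simp add: field_simps)
    then show ?thesis
      using insert 3 cc_dist_le[OF 3, of "x i" "bary I ?q x" "y i" "bary I ?q y"]
      by (simp add: bary_insert)
  qed
qed simp

text \<open>Convexity is assumed only between convex points. The induction stays among them because
  the remainder split off by \<open>bary_insert\<close> is again a convex point, by
  \<open>convex_point_bary\<close>.\<close>

lemma bary_jensen:
  assumes cvx: "\<And>x y t. convex_point x \<Longrightarrow> convex_point y \<Longrightarrow> 0 < t \<Longrightarrow> t < 1 \<Longrightarrow>
      f (cc [(t, x), (1 - t, y)]) \<le> t * f x + (1 - t) * f y"
    and "finite I" "\<And>i. i \<in> I \<Longrightarrow> 0 \<le> p i" "sum p I = 1"
    and "\<And>i. i \<in> I \<Longrightarrow> convex_point (x i)"
  shows "f (bary I p x) \<le> (\<Sum>i\<in>I. p i * f (x i) :: real)"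
  using assms(2-)
proof (induction I arbitrary: p rule: finite_induct)
  case (insert i I)
  have "0 \<le> sum p I"
    using insert by (intro sum_nonneg; auto)
  then have "p i \<le> 1" using insert by simp
  then consider "p i = 0" | "p i = 1" | "0 < p i" "p i < 1"
    using insert.prems(1)[of i] by fastforce
  then show ?case
  proof cases
    case 1
    then show ?thesis using insert by (simp add: bary_insert_0)
  next
    case 2
    then have "sum p I = 0" using insert by simp
    then have "\<And>j. j \<in> I \<Longrightarrow> p j = 0" using insert by (simp add: sum_nonneg_eq_0_iff)
    then have "(\<Sum>j\<in>I. p j * f (x j)) = 0" by (simp add: sum.neutral)
    then show ?thesis using insert 2 by (simp add: bary_insert_1)
  next
    case 3
    let ?q = "\<lambda>j. p j / (1 - p i)"
    have q: "\<And>j. j \<in> I \<Longrightarrow> 0 \<le> ?q j" "sum ?q I = 1"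
      using insert 3 by (auto simp flip: sum_divide_distrib)
    have "f (bary I ?q x) \<le> (\<Sum>j\<in>I. ?q j * f (x j))"
      using insert q by (intro insert.IH) auto
    also have "\<dots> = (\<Sum>j\<in>I. p j * f (x j)) / (1 - p i)"
      by (simp add: sum_divide_distrib)
    finally have "(1 - p i) * f (bary I ?q x) \<le> (\<Sum>j\<in>I. p j * f (x j))"
      using 3 by (simp add: field_simps)
    moreover have "convex_point (bary I ?q x)"
      using insert q by (intro convex_point_bary) auto
    ultimately show ?thesis
      using insert 3 cvx[OF _ _ 3, of "x i" "bary I ?q x"]
      by (simp add: bary_insert)
  qed
qed simp

text \<open>The weights are added up over the fibres of \<open>f\<close>, one index at a time: the
  new entry waits in the context \<open>N\<close> while the induction hypothesis treats
  \<open>K\<close>, and is then absorbed by \<open>bar_merge\<close>. Hence the generalisation over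
  \<open>N\<close>.\<close>

lemma bar_pushforward:
  assumes "finite I" "finite K" "f ` K \<subseteq> I" "\<And>i. i \<in> I \<Longrightarrow> convex_point (x i)"
    and "\<And>k. k \<in> K \<Longrightarrow> 0 \<le> p k"
    and "convex_mset (N + image_mset (\<lambda>k. (p k, x (f k))) (mset_set K))"
  shows "bar (N + image_mset (\<lambda>k. (p k, x (f k))) (mset_set K)) =
    bar (N + image_mset (\<lambda>i. (\<Sum>k | k \<in> K \<and> f k = i. p k, x i)) (mset_set I))"
  using assms(2,3,5,6)
proof (induction K arbitrary: N rule: finite_induct)
  case empty
  then show ?case using bar_zeros[OF assms(1), of "\<lambda>_. 0"] by simp
next
  case (insert k K)
  define old where "old i = (\<Sum>k | k \<in> K \<and> f k = i. p k)" for i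
  define new where "new i = (\<Sum>k' | k' \<in> insert k K \<and> f k' = i. p k')" for i
  \<comment> \<open>The new index alters only the weight over \<open>f k\<close>; the indices in
    \<open>J\<close> keep theirs.\<close>
  define J where "J = I - {f k}"
  have J: "I = insert (f k) J" "f k \<notin> J" "finite J"
    using insert.prems assms(1) by (auto simp: J_def)
  have new_eq: "new i = old i" if "i \<in> J" for i
    unfolding new_def old_def using that J by (intro sum.cong) auto
  have "{k' \<in> insert k K. f k' = f k} = insert k {k' \<in> K. f k' = f k}" by auto
  then have new_k: "new (f k) = p k + old (f k)"
    unfolding new_def old_def using insert.hyps by simp
  have old_nn: "0 \<le> old i" for i
    unfolding old_def using insert.prems by (intro sum_nonneg) auto
  have "sum old I = sum p K"
    unfolding old_def using insert assms(1) by (intro sum.group) auto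
  then have so: "old (f k) + sum old J = sum p K" using J by simp
  let ?R = "N + image_mset (\<lambda>i. (old i, x i)) (mset_set J)"
  have cR: "convex_mset (?R + {#(p k, x (f k)), (old (f k), x (f k))#})"
    using insert old_nn so J by (auto simp: convex_mset_def sum_bary_mset)
  have "bar (N + image_mset (\<lambda>k. (p k, x (f k))) (mset_set (insert k K))) =
    bar (add_mset (p k, x (f k)) N + image_mset (\<lambda>k. (p k, x (f k))) (mset_set K))"
    using insert.hyps by simp
  also have "\<dots> = bar (add_mset (p k, x (f k)) N + image_mset (\<lambda>i. (old i, x i)) (mset_set I))"
    unfolding old_def using insert by (intro insert.IH) auto
  also have "\<dots> = bar (?R + {#(p k, x (f k)), (old (f k), x (f k))#})"
    using J by (simp add: add_mset_commute)
  also have "\<dots> = bar (?R + {#(new (f k), x (f k))#})"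
    unfolding new_k using J by (intro bar_merge assms(4) cR) auto
  also have "?R = N + image_mset (\<lambda>i. (new i, x i)) (mset_set J)"
    using new_eq J by (auto intro!: image_mset_cong)
  also have "\<dots> + {#(new (f k), x (f k))#} = N + image_mset (\<lambda>i. (new i, x i)) (mset_set I)"
    using J by simp
  finally show ?case unfolding new_def .
qed

lemma bary_pushforward:
  assumes "finite I" "finite K" "f ` K \<subseteq> I" "\<And>i. i \<in> I \<Longrightarrow> convex_point (x i)"
    and "\<And>k. k \<in> K \<Longrightarrow> 0 \<le> p k" "sum p K = 1"
  shows "bary K p (\<lambda>k. x (f k)) = bary I (\<lambda>i. \<Sum>k | k \<in> K \<and> f k = i. p k) x"
  unfolding bary_def
  using bar_pushforward[where N = "{#}" and p = p and x = x, OF assms(1-5)]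
    convex_mset_bary[OF assms(2,5,6), of "\<lambda>k. x (f k)"]
  by simp

section \<open>Means of copies of one point and the convexification operator\<close>

abbreviation mean :: "nat \<Rightarrow> 'x \<Rightarrow> 'x" where
  "mean n z \<equiv> cc (replicate n (1 / real n, z))"

lemma mean_tendsto: "(\<lambda>n. mean n z) \<longlonglongrightarrow> convexification cc z"
  unfolding convexification_def using cc_convexification_convergent convergent_LIMSEQ_iff by blast

lemma mean_bar:
  assumes "n > 0"
  shows "mean n z = bar (replicate_mset n (1 / real n, z))"
    and "convex_mset (replicate_mset n (1 / real n, z))"
proof -
  show *: "convex_mset (replicate_mset n (1 / real n, z))"
    using assms by (auto simp: convex_mset_def)
  then show "mean n z = bar (replicate_mset n (1 / real n, z))"
    using bar_mset[of "replicate n (1 / real n, z)"] assms by (simp add: filter_replicate)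
qed

lemma mean_bary: "n > 0 \<Longrightarrow> mean n z = bary {..<n} (\<lambda>_. 1 / real n) (\<lambda>_. z)"
  by (simp add: mean_bar bary_def image_mset_const_eq)

lemma mean_mix:
  assumes "j > 0" "k > 0"
  shows "mean (j + k) z = cc [(j / real (j + k), mean j z), (1 - j / real (j + k), mean k z)]"
proof -
  let ?t = "j / real (j + k)"
  have jk: "j + k > 0" using assms by simp
  have t: "0 < ?t" "?t < 1" and k: "1 - ?t = k / real (j + k)"
    using assms by (auto simp: field_simps)
  have "scale_mset ?t (replicate_mset j (1 / real j, z)) +
      scale_mset (1 - ?t) (replicate_mset k (1 / real k, z)) =
      replicate_mset (j + k) (1 / real (j + k), z)"
    unfolding k using assms by (intro multiset_eqI) (simp add: scale_mset_def)
  then have "mean (j + k) z = bar {#(?t, mean j z), (1 - ?t, mean k z)#}"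
    using bar_mix[OF mean_bar(2)[OF assms(1)] mean_bar(2)[OF assms(2)] t, of z z]
    unfolding mean_bar(1)[OF assms(1)] mean_bar(1)[OF assms(2)] mean_bar(1)[OF jk] by (simp only:)
  then show ?thesis unfolding bar_pair[OF t] .
qed

lemma dist_convexification_le: "dist (convexification cc x) (convexification cc y) \<le> dist x y"
proof (rule LIMSEQ_le_const2)
  show "(\<lambda>n. dist (mean n x) (mean n y)) \<longlonglongrightarrow> dist (convexification cc x) (convexification cc y)"
    by (intro tendsto_dist mean_tendsto)
  have "dist (mean n x) (mean n y) \<le> dist x y" if "n > 0" for n
    using dist_bary_le[of "{..<n}" "\<lambda>_. 1 / real n" "\<lambda>_. x" "\<lambda>_. y"] that
    by (simp add: mean_bary)
  \<comment> \<open>The bound starts at \<open>n = 1\<close>: for \<open>n = 0\<close> the mean is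
    \<open>cc []\<close>, which is unconstrained.\<close>
  then show "\<exists>N. \<forall>n\<ge>N. dist (mean n x) (mean n y) \<le> dist x y"
    by (intro exI[of _ "1::nat"] allI impI) simp
qed

lemma cc_pair_tendsto:
  assumes "0 < t" "t < 1" "f \<longlonglongrightarrow> x" "g \<longlonglongrightarrow> y"
  shows "(\<lambda>n. cc [(t, f n), (1 - t, g n)]) \<longlonglongrightarrow> cc [(t, x), (1 - t, y)]"
proof -
  have "(\<lambda>n. t * dist (f n) x + (1 - t) * dist (g n) y) \<longlonglongrightarrow> t * dist x x + (1 - t) * dist y y"
    by (intro tendsto_intros assms)
  then have "(\<lambda>n. t * dist (f n) x + (1 - t) * dist (g n) y) \<longlonglongrightarrow> 0" by simp
  then have "(\<lambda>n. dist (cc [(t, f n), (1 - t, g n)]) (cc [(t, x), (1 - t, y)])) \<longlonglongrightarrow> 0"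
    by (rule tendsto_sandwich[OF always_eventually always_eventually tendsto_const, rotated 2])
      (simp_all add: cc_dist_le[OF assms(1,2)])
  then show ?thesis by (rule iffD2[OF tendsto_dist_iff])
qed

text \<open>For a rational weight \<open>k / m\<close>, split \<open>m * n\<close> copies of
  \<open>z\<close> into \<open>k * n\<close> and \<open>(m - k) * n\<close> copies; all three means
  tend to \<open>?K\<close> as \<open>n\<close> grows. Other weights follow by rational
  approximation and (CC.iii).\<close>

lemma convex_point_convexification: "convex_point (convexification cc z)"
  unfolding convex_point_def
proof (intro allI impI)
  let ?K = "convexification cc z"
  have rat: "cc [(real k / real m, ?K), (1 - real k / real m, ?K)] = ?K" if "0 < k" "k < m" for k m :: nat
  proof -
    have lin: "(\<lambda>n. mean (c * n) z) \<longlonglongrightarrow> ?K" if "c > 0" for c :: nat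
      using LIMSEQ_subseq_LIMSEQ[OF mean_tendsto, of "\<lambda>n. c * n"] that
      by (simp add: strict_mono_def o_def)
    have t: "0 < real k / real m" "real k / real m < 1" using that by auto
    have "(\<lambda>n. cc [(real k / real m, mean (k * n) z), (1 - real k / real m, mean ((m - k) * n) z)])
       \<longlonglongrightarrow> cc [(real k / real m, ?K), (1 - real k / real m, ?K)]"
      using that by (intro cc_pair_tendsto t lin) auto
    moreover have "\<forall>\<^sub>F n in sequentially.
        cc [(real k / real m, mean (k * n) z), (1 - real k / real m, mean ((m - k) * n) z)] = mean (m * n) z"
    proof (rule eventually_sequentiallyI[of 1])
      fix n :: nat assume n: "1 \<le> n"
      have e: "k * n + (m - k) * n = m * n"
        using that by (simp flip: distrib_right)
      have "real (k * n) / real (m * n) = real k / real m" using n by simp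
      then show "cc [(real k / real m, mean (k * n) z), (1 - real k / real m, mean ((m - k) * n) z)] = mean (m * n) z"
        using mean_mix[of "k * n" "(m - k) * n" z] that n unfolding e by simp
    qed
    ultimately have "(\<lambda>n. mean (m * n) z) \<longlonglongrightarrow> cc [(real k / real m, ?K), (1 - real k / real m, ?K)]"
      by (rule Lim_transform_eventually)
    then show ?thesis using LIMSEQ_unique lin[of m] that by simp
  qed
  fix t :: real assume t: "0 < t" "t < 1"
  \<comment> \<open>Requiring \<open>0 < k\<close> and \<open>k < m\<close> keeps the approximating
    weights strictly between 0 and 1, where (CC.iii) applies.\<close>
  have "\<exists>k m :: nat. 0 < k \<and> k < m \<and> dist (real k / real m) t < 1 / Suc n" for n
  proof -
    have "0 < 1 / real (Suc n)" by simp
    then have "max 0 (t - 1 / Suc n) < min 1 (t + 1 / Suc n)" using t by linarith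
    then obtain q where q: "q \<in> \<rat>" "max 0 (t - 1 / Suc n) < q" "q < min 1 (t + 1 / Suc n)"
      using Rats_dense_in_real by blast
    then have "q > 0" by simp
    with q(1) obtain k m :: nat where km: "m \<noteq> 0" "\<bar>q\<bar> = real k / real m"
      using Rats_abs_nat_div_natE by metis
    with q have "q = real k / real m" "0 < q" "q < 1" "dist q t < 1 / Suc n"
      by (auto simp: dist_real_def)
    with km(1) have "dist (real k / real m) t < 1 / Suc n" "0 < k" "real k < real m"
      by (auto intro!: Nat.gr0I simp: divide_less_eq_1)
    then show ?thesis by (metis of_nat_less_iff)
  qed
  then obtain k m :: "nat \<Rightarrow> nat" where km: "\<And>n. 0 < k n" "\<And>n. k n < m n"
      "\<And>n. dist (real (k n) / real (m n)) t < 1 / Suc n"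
    by metis
  have lim: "(\<lambda>n. real (k n) / real (m n)) \<longlonglongrightarrow> t"
  proof (rule metric_LIMSEQ_I)
    fix e :: real assume "e > 0"
    then obtain N where "1 / Suc N < e" by (metis nat_approx_posE)
    then have "dist (real (k n) / real (m n)) t < e" if "n \<ge> N" for n
      using km(3)[of n] that by (smt (verit) frac_le of_nat_0_less_iff of_nat_mono Suc_le_mono zero_less_Suc)
    then show "\<exists>N. \<forall>n\<ge>N. dist (real (k n) / real (m n)) t < e" by blast
  qed
  have b: "0 < real (k n) / real (m n) \<and> real (k n) / real (m n) < 1" for n
    using km(1,2)[of n] by auto
  have "(\<lambda>n. cc [(real (k n) / real (m n), ?K), (1 - real (k n) / real (m n), ?K)])
      \<longlonglongrightarrow> cc [(t, ?K), (1 - t, ?K)]"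
    by (rule cc_continuous_weights[OF b lim t])
  then show "cc [(t, ?K), (1 - t, ?K)] = ?K"
    using rat km(1,2) by (simp add: LIMSEQ_const_iff)
qed

lemma convexification_le:
  fixes \<phi> :: "'x \<Rightarrow> real"
  assumes "midpoint_convex cc \<phi>" "continuous_on UNIV \<phi>"
  shows "\<phi> (convexification cc z) \<le> \<phi> z"
proof (rule LIMSEQ_le_const2)
  have "(\<lambda>n. mean (2 ^ n) z) \<longlonglongrightarrow> convexification cc z"
    using LIMSEQ_subseq_LIMSEQ[OF mean_tendsto, of "\<lambda>n. 2 ^ n"]
    by (simp add: strict_mono_def o_def)
  then show "(\<lambda>n. \<phi> (mean (2 ^ n) z)) \<longlonglongrightarrow> \<phi> (convexification cc z)"
    by (rule continuous_on_tendsto_compose[OF assms(2)]) auto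
  have "\<phi> (mean (2 ^ n) z) \<le> \<phi> z" for n
  proof (induction n)
    case (Suc n)
    let ?m = "mean (2 ^ n) z"
    have "mean (2 ^ Suc n) z = cc [(1/2, ?m), (1/2, ?m)]"
      using mean_mix[of "2 ^ n" "2 ^ n" z, folded mult_2] by simp
    moreover have "\<phi> (cc [(1/2, ?m), (1/2, ?m)]) \<le> (\<phi> ?m + \<phi> ?m) / 2"
      using assms(1) unfolding midpoint_convex_def by blast
    ultimately show ?case using Suc by simp
  qed (simp add: cc_single)
  then show "\<exists>N. \<forall>n\<ge>N. \<phi> (mean (2 ^ n) z) \<le> \<phi> z" by blast
qed

section \<open>Convexity along segments between convex points\<close>

lemma dist_segment_le:
  assumes "convex_point x" "convex_point y" "0 \<le> s" "s \<le> t" "t \<le> 1"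
  shows "dist (bar {#(s, x), (1 - s, y)#}) (bar {#(t, x), (1 - t, y)#}) \<le> (t - s) * dist x y"
proof -
  \<comment> \<open>Both points are written with the three weights \<open>s\<close>,
    \<open>t - s\<close>, \<open>1 - t\<close>; the families then differ only in the middle entry,
    which is \<open>y\<close> for one and \<open>x\<close> for the other.\<close>
  let ?p = "\<lambda>i::nat. if i = 0 then s else if i = 1 then t - s else 1 - t"
  let ?x = "\<lambda>i::nat. if i = 0 then x else y" and ?y = "\<lambda>i::nat. if i \<le> 1 then x else y"
  have c1: "convex_mset ({#(s, x)#} + {#(t - s, y), (1 - t, y)#})"
    and c2: "convex_mset ({#(1 - t, y)#} + {#(s, x), (t - s, x)#})"
    using assms by (auto simp: convex_mset_def)
  have "bary {0,1,2} ?p ?x = bar {#(s, x), (1 - s, y)#}"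
    using bar_merge[OF assms(2) c1] by (simp add: bary_def add_mset_commute numeral_2_eq_2)
  moreover have "bary {0,1,2} ?p ?y = bar {#(t, x), (1 - t, y)#}"
    using bar_merge[OF assms(1) c2] by (simp add: bary_def add_mset_commute numeral_2_eq_2)
  moreover have "dist (bary {0,1,2} ?p ?x) (bary {0,1,2} ?p ?y) \<le>
      (\<Sum>i\<in>{0,1,2}. ?p i * dist (?x i) (?y i))"
    using assms by (intro dist_bary_le) auto
  ultimately show ?thesis by (simp add: dist_commute)
qed

text \<open>The parametrisation of a segment respects midpoints, so midpoint convexity on the space
  passes to a function of the real parameter. As in \<open>convex_point_bar_pair\<close>, the halved
  weights of equal points are merged.\<close>

lemma bar_midpoint:
  assumes "convex_point x" "convex_point y" "0 \<le> a" "a \<le> 1" "0 \<le> b" "b \<le> 1"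
  shows "bar {#((a + b) / 2, x), (1 - (a + b) / 2, y)#} =
    cc [(1/2, bar {#(a, x), (1 - a, y)#}), (1/2, bar {#(b, x), (1 - b, y)#})]"
proof -
  let ?N = "{#(a, x), (1 - a, y)#}" and ?W = "{#(b, x), (1 - b, y)#}"
  have c: "convex_mset ?N" "convex_mset ?W" using assms by (auto simp: convex_mset_def)
  have c2: "convex_mset ({#((1 - a) / 2, y), ((1 - b) / 2, y)#} + {#(a / 2, x), (b / 2, x)#})"
    using assms by (simp add: convex_mset_def) (simp add: field_simps)
  have c3: "convex_mset ({#((a + b) / 2, x)#} + {#((1 - a) / 2, y), ((1 - b) / 2, y)#})"
    using assms by (simp add: convex_mset_def) (simp add: field_simps)
  have "cc [(1/2, bar ?N), (1/2, bar ?W)] = bar (scale_mset (1/2) ?N + scale_mset (1 - 1/2) ?W)"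
    using bar_mix[OF c, of "1/2"] bar_pair[of "1/2"] by simp
  also have "\<dots> = bar ({#((1 - a) / 2, y), ((1 - b) / 2, y)#} + {#(a / 2, x), (b / 2, x)#})"
    by (simp add: add_mset_commute)
  also have "\<dots> = bar ({#((a + b) / 2, x)#} + {#((1 - a) / 2, y), ((1 - b) / 2, y)#})"
    by (subst bar_merge[OF assms(1) c2]) (simp add: add_divide_distrib add_mset_commute)
  also have "\<dots> = bar ({#((a + b) / 2, x)#} + {#((1 - a) / 2 + (1 - b) / 2, y)#})"
    by (rule bar_merge[OF assms(2) c3])
  also have "(1 - a) / 2 + (1 - b) / 2 = 1 - (a + b) / 2" by (simp add: field_simps)
  finally show ?thesis by (simp add: add_mset_commute)
qed

text \<open>The difference of \<^term>\<open>\<phi>\<close> along a segment and its linear interpolation is midpoint convex and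
  vanishes at the ends; reflecting an end in a maximum point shows that the maximum is at most 0.\<close>

lemma midpoint_convex_imp_convex:
  fixes \<phi> :: "'x \<Rightarrow> real"
  assumes mid: "midpoint_convex cc \<phi>" and cont: "continuous_on UNIV \<phi>"
    and xy: "convex_point x" "convex_point y" and t: "0 < t" "t < 1"
  shows "\<phi> (cc [(t, x), (1 - t, y)]) \<le> t * \<phi> x + (1 - t) * \<phi> y"
proof -
  define g where "g s = bar {#(s, x), (1 - s, y)#}" for s
  define h where "h s = \<phi> (g s) - (s * \<phi> x + (1 - s) * \<phi> y)" for s
  have d: "dist (g a) (g b) \<le> dist x y * dist a b" if "a \<in> {0..1}" "b \<in> {0..1}" for a b
    using dist_segment_le[OF xy, of a b] dist_segment_le[OF xy, of b a] that
    by (cases "a \<le> b") (auto simp: g_def dist_real_def dist_commute mult.commute)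
  have "continuous_on {0..1} g"
    by (rule lipschitz_on_continuous_on[of "dist x y"], rule lipschitz_onI) (use d in auto)
  then have "continuous_on {0..1} (\<lambda>s. \<phi> (g s))"
    by (rule continuous_on_compose2[OF cont]) auto
  then have "continuous_on {0..1} h" unfolding h_def by (intro continuous_intros)
  then obtain m where m: "m \<in> {0..1}" "\<And>s. s \<in> {0..1} \<Longrightarrow> h s \<le> h m"
    using continuous_attains_sup[of "{0..1::real}" h] by auto
  have h01: "h 0 = 0" "h 1 = 0"
    using bar_zero[of x "{#(1, y)#}"] bar_zero[of y "{#(1, x)#}"]
    by (auto simp: h_def g_def add_mset_commute)
  have hm: "h ((a + b) / 2) \<le> (h a + h b) / 2" if "a \<in> {0..1}" "b \<in> {0..1}" for a b
  proof -
    have "g ((a + b) / 2) = cc [(1/2, g a), (1/2, g b)]"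
      using bar_midpoint[OF xy, of a b] that by (simp add: g_def)
    then have "\<phi> (g ((a + b) / 2)) \<le> (\<phi> (g a) + \<phi> (g b)) / 2"
      using mid by (simp add: midpoint_convex_def)
    then show ?thesis by (simp add: h_def field_simps)
  qed
  have "h m \<le> 0"
  proof (cases "m \<le> 1/2")
    case True
    \<comment> \<open>The parameter \<open>m\<close> is the midpoint of \<open>0\<close> and
      \<open>2 * m\<close>, and \<open>2 * m\<close> is still at most 1. With \<open>h 0 = 0\<close>
      and maximality this gives \<open>h m \<le> h m / 2\<close>.\<close>
    have "h m \<le> (h 0 + h (2 * m)) / 2" using hm[of 0 "2 * m"] m True by simp
    moreover have "h (2 * m) \<le> h m" using m True by auto
    ultimately show ?thesis using h01 by simp
  next
    case False
    have "h m \<le> (h (2 * m - 1) + h 1) / 2" using hm[of "2 * m - 1" 1] m False by simp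
    moreover have "h (2 * m - 1) \<le> h m" using m False by auto
    ultimately show ?thesis using h01 by simp
  qed
  with m(2)[of t] t have "h t \<le> 0" by simp
  then show ?thesis using bar_pair[OF t] by (simp add: h_def g_def)
qed

end

section \<open>Conditional expectations of simple elements\<close>

definition measurable_partition :: "'a measure \<Rightarrow> 'i set \<Rightarrow> ('i \<Rightarrow> 'a set) \<Rightarrow> bool" where
  "measurable_partition M I A \<longleftrightarrow> finite I \<and> (\<forall>i\<in>I. A i \<in> sets M) \<and> disjoint_family_on A I \<and>
     (\<Union>i\<in>I. A i) = space M"

lemma sum_indicator_partition:
  assumes "measurable_partition M I A" "i \<in> I" "\<omega> \<in> A i"
  shows "(\<Sum>j\<in>I. c j * indicator (A j) \<omega>) = (c i :: real)"
proof -
  have "(\<Sum>j\<in>I. c j * indicator (A j) \<omega>) = (\<Sum>j\<in>I. if j = i then c j else 0)"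
    using assms by (intro sum.cong)
      (auto simp: measurable_partition_def disjoint_family_on_def indicator_def)
  then show ?thesis using assms by (simp add: measurable_partition_def)
qed

context
  fixes M G :: "'a measure"
  assumes prob: "prob_space M" and subalg: "subalgebra M G"
begin

interpretation prob_space M by (rule prob)

interpretation finite_measure_subalgebra M G
  by unfold_locales (rule subalg)

lemma cond_exp_partition:
  assumes part: "measurable_partition M I A"
    and f: "\<And>i \<omega>. i \<in> I \<Longrightarrow> \<omega> \<in> A i \<Longrightarrow> f \<omega> = (c i :: real)"
  shows "integrable M f"
    and "AE \<omega> in M. real_cond_exp M G f \<omega> = (\<Sum>i\<in>I. real_cond_exp M G (indicator (A i)) \<omega> * c i)"
proof -
  \<comment> \<open>Extending by the empty set makes every index measurable, since
    \<open>real_cond_exp_sum\<close> asks for integrability at all indices.\<close>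
  define B where "B i = (if i \<in> I then A i else {})" for i
  have B [measurable]: "B i \<in> sets M" for i
    using part by (simp add: B_def measurable_partition_def)
  have int: "integrable M (\<lambda>\<omega>. c i * indicator (B i) \<omega>)" for i
    by (intro integrable_mult_right integrable_real_indicator) (auto simp: less_top[symmetric])
  let ?g = "\<lambda>\<omega>. \<Sum>i\<in>I. c i * indicator (B i) \<omega>"
  have fg: "f \<omega> = ?g \<omega>" if \<omega>: "\<omega> \<in> space M" for \<omega>
  proof -
    obtain i where i: "i \<in> I" "\<omega> \<in> A i" using part \<omega> by (auto simp: measurable_partition_def)
    have "?g \<omega> = (\<Sum>i\<in>I. c i * indicator (A i) \<omega>)" by (intro sum.cong) (auto simp: B_def)
    then show ?thesis using sum_indicator_partition[OF part i] f[OF i] by simp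
  qed
  have g: "integrable M ?g" using int by auto
  then show fi: "integrable M f" by (rule iffD2[OF Bochner_Integration.integrable_cong[OF refl], rotated]) (rule fg)
  have "AE \<omega> in M. real_cond_exp M G f \<omega> = real_cond_exp M G ?g \<omega>"
    by (rule real_cond_exp_cong) (use fg fi g in auto)
  moreover have "AE \<omega> in M. real_cond_exp M G ?g \<omega> =
      (\<Sum>i\<in>I. real_cond_exp M G (\<lambda>\<omega>. c i * indicator (B i) \<omega>) \<omega>)"
    by (rule real_cond_exp_sum[OF int])
  moreover have "AE \<omega> in M. \<forall>i\<in>I. real_cond_exp M G (\<lambda>\<omega>. c i * indicator (B i) \<omega>) \<omega> =
      c i * real_cond_exp M G (indicator (B i)) \<omega>"
  proof (rule AE_finite_allI)
    show "finite I" using part by (simp add: measurable_partition_def)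
    show "AE \<omega> in M. real_cond_exp M G (\<lambda>\<omega>. c i * indicator (B i) \<omega>) \<omega> =
      c i * real_cond_exp M G (indicator (B i)) \<omega>" for i
      by (rule real_cond_exp_cmult) (auto simp: less_top[symmetric])
  qed
  ultimately show "AE \<omega> in M. real_cond_exp M G f \<omega> =
      (\<Sum>i\<in>I. real_cond_exp M G (indicator (A i)) \<omega> * c i)"
    by eventually_elim (simp add: B_def mult.commute)
qed

text \<open>The sum is the conditional expectation of the constant 1. Outside a null set the
  conditional probabilities are thus convex weights, and the results on \<open>bary\<close> apply
  pointwise.\<close>

lemma AE_cond_prob_partition:
  assumes "measurable_partition M I A"
  shows "AE \<omega> in M. (\<forall>i\<in>I. 0 \<le> real_cond_exp M G (indicator (A i)) \<omega>) \<and>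
    (\<Sum>i\<in>I. real_cond_exp M G (indicator (A i)) \<omega>) = 1"
proof -
  have "AE \<omega> in M. real_cond_exp M G (\<lambda>_. 1) \<omega> = (1 :: real)"
    by (rule real_cond_exp_F_meas) auto
  moreover have "AE \<omega> in M. real_cond_exp M G (\<lambda>_. 1) \<omega> =
      (\<Sum>i\<in>I. real_cond_exp M G (indicator (A i)) \<omega> * 1)"
    by (rule cond_exp_partition[OF assms]) auto
  moreover have "AE \<omega> in M. \<forall>i\<in>I. 0 \<le> real_cond_exp M G (indicator (A i)) \<omega>"
  proof (rule AE_finite_allI)
    show "AE \<omega> in M. 0 \<le> real_cond_exp M G (indicator (A i)) \<omega>" if "i \<in> I" for i
      using assms that by (intro real_cond_exp_pos) (auto simp: measurable_partition_def)
  qed (use assms in \<open>simp add: measurable_partition_def\<close>)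
  ultimately show ?thesis by eventually_elim simp
qed

text \<open>The indicator of \<open>A i\<close> is constant on each part of the finer partition, so
  almost surely its conditional probability is the sum of those of the parts sent to
  \<open>i\<close> by \<open>f\<close>. The equality is then
  \<open>bary_pushforward\<close>.\<close>

lemma AE_bary_refine:
  fixes cc :: "(real \<times> 'x::metric_space) list \<Rightarrow> 'x"
  assumes cc: "cc_space cc"
    and A: "measurable_partition M I A" and D: "measurable_partition M K D"
    and f: "\<And>k. k \<in> K \<Longrightarrow> f k \<in> I \<and> D k \<subseteq> A (f k)"
    and x: "\<And>i. i \<in> I \<Longrightarrow> cc_space.convex_point cc (x i)"
  shows "AE \<omega> in M. cc_space.bary cc I (\<lambda>i. real_cond_exp M G (indicator (A i)) \<omega>) x =
    cc_space.bary cc K (\<lambda>k. real_cond_exp M G (indicator (D k)) \<omega>) (\<lambda>k. x (f k))"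
proof -
  interpret cc_space cc by (rule cc)
  have fin: "finite I" "finite K" using A D by (auto simp: measurable_partition_def)
  have "AE \<omega> in M. \<forall>i\<in>I. real_cond_exp M G (indicator (A i)) \<omega> =
      (\<Sum>k\<in>K. real_cond_exp M G (indicator (D k)) \<omega> * (if f k = i then 1 else 0))"
  proof (rule AE_finite_allI[OF fin(1)])
    fix i assume i: "i \<in> I"
    have "indicator (A i) \<omega> = (if f k = i then 1 else 0 :: real)" if "k \<in> K" "\<omega> \<in> D k" for k \<omega>
    proof -
      have "\<omega> \<in> A (f k)" "f k \<in> I" using f[OF that(1)] that(2) by auto
      then have "\<omega> \<in> A i \<longleftrightarrow> f k = i"
        using A i unfolding measurable_partition_def disjoint_family_on_def by blast
      then show ?thesis by (simp add: indicator_def)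
    qed
    then show "AE \<omega> in M. real_cond_exp M G (indicator (A i)) \<omega> =
      (\<Sum>k\<in>K. real_cond_exp M G (indicator (D k)) \<omega> * (if f k = i then 1 else 0))"
      by (rule cond_exp_partition(2)[OF D])
  qed
  moreover note AE_cond_prob_partition[OF D]
  ultimately show ?thesis
  proof eventually_elim
    case (elim \<omega>)
    let ?q = "\<lambda>k. real_cond_exp M G (indicator (D k)) \<omega>"
    have "bary K ?q (\<lambda>k. x (f k)) = bary I (\<lambda>i. \<Sum>k | k \<in> K \<and> f k = i. ?q k) x"
      using elim f x fin by (intro bary_pushforward) auto
    also have "\<dots> = bary I (\<lambda>i. real_cond_exp M G (indicator (A i)) \<omega>) x"
    proof (rule bary_cong)
      fix i assume i: "i \<in> I"
      have "(\<Sum>k | k \<in> K \<and> f k = i. ?q k) = (\<Sum>k\<in>K. if f k = i then ?q k else 0)"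
        using fin by (simp add: sum.inter_filter)
      also have "\<dots> = (\<Sum>k\<in>K. ?q k * (if f k = i then 1 else 0))"
        by (intro sum.cong) auto
      also have "\<dots> = real_cond_exp M G (indicator (A i)) \<omega>" using elim i by simp
      finally show "(\<Sum>k | k \<in> K \<and> f k = i. ?q k) = real_cond_exp M G (indicator (A i)) \<omega>" .
    qed simp
    finally show ?case ..
  qed
qed

section \<open>Contraction and Jensen inequalities for simple elements\<close>

lemma simple_representation_exists:
  assumes "simple_function M S"
  shows "\<exists>ws. simple_representation M S ws"
proof -
  obtain L where L: "set L = S ` space M" "distinct L"
    using finite_distinct_list[OF simple_functionD(1)[OF assms]] by auto
  let ?ws = "map (\<lambda>x. (S -` {x} \<inter> space M, x)) L"
  have "disjoint_family_on (\<lambda>i. fst (?ws ! i)) {..<length ?ws}"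
    using L(2) by (auto simp: disjoint_family_on_def nth_eq_iff_index_eq)
  moreover have "(\<Union>i<length ?ws. fst (?ws ! i)) = (\<Union>x\<in>set L. S -` {x} \<inter> space M)"
    by (auto simp: set_conv_nth)
  moreover have "\<dots> = space M" using L(1) by auto
  moreover have "\<forall>(A, x)\<in>set ?ws. A \<in> sets M \<and> (\<forall>\<omega>\<in>A. S \<omega> = x)"
    using simple_functionD(2)[OF assms] by auto
  ultimately have "simple_representation M S ?ws"
    unfolding simple_representation_def by simp
  then show ?thesis by blast
qed

text \<open>A normal form: later arguments use that the representation chosen by \<open>SOME\<close>
  is some partition on whose parts \<open>S\<close> is constant, and nothing else about it.\<close>

lemma simple_cond_exp_bary:
  fixes cc :: "(real \<times> 'x::metric_space) list \<Rightarrow> 'x"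
  assumes cc: "cc_space cc" and S: "simple_function M S"
  obtains n A x where "measurable_partition M {..<n::nat} A"
    and "\<forall>i<n. \<forall>\<omega>\<in>A i. S \<omega> = x i"
    and "AE \<omega> in M. simple_cond_exp cc M G S \<omega> =
      cc_space.bary cc {..<n} (\<lambda>i. real_cond_exp M G (indicator (A i)) \<omega>) (\<lambda>i. convexification cc (x i))"
proof -
  interpret cc_space cc by (rule cc)
  define ws where "ws = (SOME ws. simple_representation M S ws)"
  have ws: "simple_representation M S ws"
    unfolding ws_def by (rule someI_ex[OF simple_representation_exists[OF S]])
  define n where "n = length ws"
  define A where "A i = fst (ws ! i)" for i
  define x where "x i = snd (ws ! i)" for i
  have wsi: "ws ! i \<in> set ws" "ws ! i = (A i, x i)" if "i < n" for i
    using that by (auto simp: n_def A_def x_def)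
  have A_eq: "(\<lambda>i. fst (ws ! i)) = A" by (rule ext) (simp add: A_def)
  have mem: "A i \<in> sets M \<and> (\<forall>\<omega>\<in>A i. S \<omega> = x i)" if "i < n" for i
  proof -
    have "case ws ! i of (A, x) \<Rightarrow> A \<in> sets M \<and> (\<forall>\<omega>\<in>A. S \<omega> = x)"
      by (rule bspec[OF conjunct1[OF ws[unfolded simple_representation_def]] wsi(1)[OF that]])
    then show ?thesis using wsi(2)[OF that] by simp
  qed
  have part: "measurable_partition M {..<n} A"
    using conjunct2[OF ws[unfolded simple_representation_def A_eq]] mem
    unfolding measurable_partition_def n_def[symmetric] A_def[symmetric] by blast
  from AE_cond_prob_partition[OF part]
  have "AE \<omega> in M. simple_cond_exp cc M G S \<omega> =
      bary {..<n} (\<lambda>i. real_cond_exp M G (indicator (A i)) \<omega>) (\<lambda>i. convexification cc (x i))"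
  proof eventually_elim
    case (elim \<omega>)
    let ?p = "\<lambda>i. real_cond_exp M G (indicator (A i)) \<omega>"
    let ?l = "map (\<lambda>i. (?p i, convexification cc (x i))) [0..<n]"
    have l: "map (\<lambda>(A, x). (real_cond_exp M G (indicator A) \<omega>, convexification cc x)) ws = ?l"
      by (rule nth_equalityI) (auto simp: n_def A_def x_def split: prod.split)
    have m: "mset ?l = image_mset (\<lambda>i. (?p i, convexification cc (x i))) (mset_set {..<n})"
      by (simp add: atLeast0LessThan)
    have "convex_mset (mset ?l)"
      unfolding m using elim by (intro convex_mset_bary) auto
    then have "bar (mset ?l) = cc (filter (\<lambda>w. fst w \<noteq> 0) ?l)" by (rule bar_mset)
    then show ?case
      unfolding simple_cond_exp_def ws_def[symmetric] l bary_def m by simp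
  qed
  with part show ?thesis using that mem by blast
qed

lemma AE_dist_simple_cond_exp_le:
  fixes cc :: "(real \<times> 'x::metric_space) list \<Rightarrow> 'x"
  assumes cc: "cc_space cc" and S: "simple_function M S" and T: "simple_function M T"
  shows "AE \<omega> in M. dist (simple_cond_exp cc M G S \<omega>) (simple_cond_exp cc M G T \<omega>) \<le>
    real_cond_exp M G (\<lambda>\<omega>. dist (S \<omega>) (T \<omega>)) \<omega>"
proof -
  interpret cc_space cc by (rule cc)
  let ?K = "convexification cc"
  obtain m A x where A: "measurable_partition M {..<m::nat} A"
    and x: "\<forall>i<m. \<forall>\<omega>\<in>A i. S \<omega> = x i"
    and Sb: "AE \<omega> in M. simple_cond_exp cc M G S \<omega> =
      bary {..<m} (\<lambda>i. real_cond_exp M G (indicator (A i)) \<omega>) (\<lambda>i. ?K (x i))"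
    by (rule simple_cond_exp_bary[OF cc S])
  obtain n B y where B: "measurable_partition M {..<n::nat} B"
    and y: "\<forall>i<n. \<forall>\<omega>\<in>B i. T \<omega> = y i"
    and Tb: "AE \<omega> in M. simple_cond_exp cc M G T \<omega> =
      bary {..<n} (\<lambda>i. real_cond_exp M G (indicator (B i)) \<omega>) (\<lambda>i. ?K (y i))"
    by (rule simple_cond_exp_bary[OF cc T])
  \<comment> \<open>Over the common refinement both conditional expectations become combinations
    with the same weights, so \<open>dist_bary_le\<close> applies. Empty intersections are kept as
    parts.\<close>
  define J where "J = {..<m} \<times> {..<n}"
  define D where "D k = A (fst k) \<inter> B (snd k)" for k
  have D: "measurable_partition M J D"
    unfolding measurable_partition_def
  proof (intro conjI)
    show "finite J" "\<forall>k\<in>J. D k \<in> sets M"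
      using A B by (auto simp: J_def D_def measurable_partition_def)
    show "disjoint_family_on D J"
      using A B unfolding disjoint_family_on_def measurable_partition_def J_def D_def by fastforce
    have "(\<Union>k\<in>J. D k) = (\<Union>i<m. A i) \<inter> (\<Union>j<n. B j)"
      by (auto simp: J_def D_def)
    then show "(\<Union>k\<in>J. D k) = space M"
      using A B by (simp add: measurable_partition_def)
  qed
  have "AE \<omega> in M. real_cond_exp M G (\<lambda>\<omega>. dist (S \<omega>) (T \<omega>)) \<omega> =
      (\<Sum>k\<in>J. real_cond_exp M G (indicator (D k)) \<omega> * dist (x (fst k)) (y (snd k)))"
    by (rule cond_exp_partition(2)[OF D]) (auto simp: J_def D_def x y)
  moreover have "AE \<omega> in M. bary {..<m} (\<lambda>i. real_cond_exp M G (indicator (A i)) \<omega>) (\<lambda>i. ?K (x i)) =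
      bary J (\<lambda>k. real_cond_exp M G (indicator (D k)) \<omega>) (\<lambda>k. ?K (x (fst k)))"
    by (rule AE_bary_refine[OF cc A D]) (auto simp: J_def D_def convex_point_convexification)
  moreover have "AE \<omega> in M. bary {..<n} (\<lambda>i. real_cond_exp M G (indicator (B i)) \<omega>) (\<lambda>i. ?K (y i)) =
      bary J (\<lambda>k. real_cond_exp M G (indicator (D k)) \<omega>) (\<lambda>k. ?K (y (snd k)))"
    by (rule AE_bary_refine[OF cc B D]) (auto simp: J_def D_def convex_point_convexification)
  moreover note AE_cond_prob_partition[OF D] Sb Tb
  ultimately show ?thesis
  proof eventually_elim
    case (elim \<omega>)
    let ?q = "\<lambda>k. real_cond_exp M G (indicator (D k)) \<omega>"
    have "dist (simple_cond_exp cc M G S \<omega>) (simple_cond_exp cc M G T \<omega>) \<le>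
        (\<Sum>k\<in>J. ?q k * dist (?K (x (fst k))) (?K (y (snd k))))"
      unfolding elim using elim by (intro dist_bary_le) (auto simp: J_def)
    also have "\<dots> \<le> (\<Sum>k\<in>J. ?q k * dist (x (fst k)) (y (snd k)))"
      using elim by (intro sum_mono mult_left_mono dist_convexification_le) auto
    finally show ?case using elim by simp
  qed
qed

lemma AE_simple_cond_exp_jensen:
  fixes cc :: "(real \<times> 'x::metric_space) list \<Rightarrow> 'x" and \<phi> :: "'x \<Rightarrow> real"
  assumes cc: "cc_space cc" and S: "simple_function M S"
    and mid: "midpoint_convex cc \<phi>" and cont: "continuous_on UNIV \<phi>"
  shows "AE \<omega> in M. \<phi> (simple_cond_exp cc M G S \<omega>) \<le> real_cond_exp M G (\<lambda>\<omega>. \<phi> (S \<omega>)) \<omega>"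
proof -
  interpret cc_space cc by (rule cc)
  let ?K = "convexification cc"
  obtain m A x where A: "measurable_partition M {..<m::nat} A"
    and x: "\<forall>i<m. \<forall>\<omega>\<in>A i. S \<omega> = x i"
    and Sb: "AE \<omega> in M. simple_cond_exp cc M G S \<omega> =
      bary {..<m} (\<lambda>i. real_cond_exp M G (indicator (A i)) \<omega>) (\<lambda>i. ?K (x i))"
    by (rule simple_cond_exp_bary[OF cc S])
  have "AE \<omega> in M. real_cond_exp M G (\<lambda>\<omega>. \<phi> (S \<omega>)) \<omega> =
      (\<Sum>i<m. real_cond_exp M G (indicator (A i)) \<omega> * \<phi> (x i))"
    by (rule cond_exp_partition(2)[OF A]) (auto simp: x)
  moreover note AE_cond_prob_partition[OF A] Sb
  ultimately show ?thesis
  proof eventually_elim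
    case (elim \<omega>)
    let ?p = "\<lambda>i. real_cond_exp M G (indicator (A i)) \<omega>"
    \<comment> \<open>Jensen is used at the points \<open>?K (x i)\<close>, which are convex points;
      the values \<open>x i\<close> need not be, and enter only through
      \<open>convexification_le\<close>.\<close>
    have "\<phi> (simple_cond_exp cc M G S \<omega>) \<le> (\<Sum>i<m. ?p i * \<phi> (?K (x i)))"
      unfolding elim using elim
      by (intro bary_jensen midpoint_convex_imp_convex[OF mid cont])
        (auto simp: convex_point_convexification)
    also have "\<dots> \<le> (\<Sum>i<m. ?p i * \<phi> (x i))"
      using elim by (intro sum_mono mult_left_mono convexification_le mid cont) auto
    finally show ?case using elim by simp
  qed
qed

section \<open>Almost sure convergence of the conditional expectations of errors\<close>

lemma AE_cond_exp_tendsto_0_subseq: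
  fixes f :: "nat \<Rightarrow> 'a \<Rightarrow> real"
  assumes f: "\<And>n. integrable M (f n)" and nonneg: "\<And>n \<omega>. 0 \<le> f n \<omega>"
    and lim: "(\<lambda>n. \<integral>\<omega>. f n \<omega> \<partial>M) \<longlonglongrightarrow> 0"
  obtains r where "strict_mono (r :: nat \<Rightarrow> nat)"
    "AE \<omega> in M. (\<lambda>n. real_cond_exp M G (f (r n)) \<omega>) \<longlonglongrightarrow> 0"
proof -
  \<comment> \<open>For nonnegative functions conditioning preserves the L1 norm, so convergence in
    L1 carries over and yields an almost surely convergent subsequence.\<close>
  have "(\<integral>\<omega>. norm (real_cond_exp M G (f n) \<omega>) \<partial>M) = (\<integral>\<omega>. f n \<omega> \<partial>M)" for n
  proof -
    have "AE \<omega> in M. 0 \<le> real_cond_exp M G (f n) \<omega>"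
      using f nonneg by (intro real_cond_exp_pos) auto
    then have "(\<integral>\<omega>. norm (real_cond_exp M G (f n) \<omega>) \<partial>M) = (\<integral>\<omega>. real_cond_exp M G (f n) \<omega> \<partial>M)"
      by (intro integral_cong_AE) auto
    then show ?thesis using real_cond_exp_int(2)[OF f] by simp
  qed
  then show ?thesis
    using tendsto_L1_AE_subseq[of M "\<lambda>n. real_cond_exp M G (f n)"] real_cond_exp_int(1)[OF f] lim that
    by auto
qed

text \<open>Almost surely the conditional expectations decrease and are bounded below, hence
  converge; the subsequence identifies the limit as 0. Convergence along all indices matters because
  \<open>cc_cond_exp\<close> is a limit of the full sequence.\<close>

lemma AE_cond_exp_decseq_tendsto_0:
  fixes f :: "nat \<Rightarrow> 'a \<Rightarrow> real"
  assumes f: "\<And>n. integrable M (f n)" and nonneg: "\<And>n \<omega>. 0 \<le> f n \<omega>"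
    and dec: "\<And>n \<omega>. f (Suc n) \<omega> \<le> f n \<omega>"
    and lim: "(\<lambda>n. \<integral>\<omega>. f n \<omega> \<partial>M) \<longlonglongrightarrow> 0"
  shows "AE \<omega> in M. (\<lambda>n. real_cond_exp M G (f n) \<omega>) \<longlonglongrightarrow> 0"
proof -
  obtain r where r: "strict_mono (r :: nat \<Rightarrow> nat)"
      "AE \<omega> in M. (\<lambda>n. real_cond_exp M G (f (r n)) \<omega>) \<longlonglongrightarrow> 0"
    using f nonneg lim by (rule AE_cond_exp_tendsto_0_subseq)
  have "AE \<omega> in M. \<forall>n. real_cond_exp M G (f (Suc n)) \<omega> \<le> real_cond_exp M G (f n) \<omega>"
    unfolding AE_all_countable using f dec by (intro allI real_cond_exp_mono) auto
  moreover have "AE \<omega> in M. \<forall>n. 0 \<le> real_cond_exp M G (f n) \<omega>"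
    unfolding AE_all_countable using f nonneg by (intro allI real_cond_exp_pos) auto
  ultimately show ?thesis using r(2)
  proof eventually_elim
    case (elim \<omega>)
    let ?a = "\<lambda>n. real_cond_exp M G (f n) \<omega>"
    have "decseq ?a" using elim by (intro decseq_SucI) auto
    then obtain L where L: "?a \<longlonglongrightarrow> L" using elim decseq_convergent by metis
    then have "(?a \<circ> r) \<longlonglongrightarrow> L" using r(1) by (rule LIMSEQ_subseq_LIMSEQ)
    then have "L = 0" using elim LIMSEQ_unique by (auto simp: o_def)
    with L show ?case by simp
  qed
qed

end

section \<open>Approximation by simple elements\<close>

lemma dist_nearest_point: "dist (nearest_point u n x) x = Min ((\<lambda>j. dist (u j) x) ` {0..n})"
proof -
  let ?D = "(\<lambda>j. dist (u j) x) ` {0..n}"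
  have "Min ?D \<in> ?D" by (rule Min_in) auto
  then have "\<exists>i. i \<le> n \<and> dist (u i) x = Min ?D" by force
  from LeastI_ex[OF this] show ?thesis by (simp add: nearest_point_def)
qed

lemma dist_nearest_point_le: "j \<le> n \<Longrightarrow> dist (nearest_point u n x) x \<le> dist (u j) x"
  unfolding dist_nearest_point by (rule Min_le) auto

lemma dist_nearest_point_Suc_le:
  "dist (nearest_point u (Suc n) x) x \<le> dist (nearest_point u n x) x"
  unfolding dist_nearest_point by (rule Min_antimono) auto

lemma dist_nearest_point_tendsto_0:
  assumes "closure (range u) = UNIV"
  shows "(\<lambda>n. dist (nearest_point u n x) x) \<longlonglongrightarrow> 0"
proof (rule metric_LIMSEQ_I)
  fix e :: real assume "e > 0"
  moreover have "x \<in> closure (range u)" using assms by simp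
  ultimately obtain j where j: "dist (u j) x < e" unfolding closure_approachable by blast
  have "dist (dist (nearest_point u n x) x) 0 < e" if "n \<ge> j" for n
    using dist_nearest_point_le[of j n u x] that j by (simp add: dist_real_def)
  then show "\<exists>N. \<forall>n\<ge>N. dist (dist (nearest_point u n x) x) 0 < e" by blast
qed

lemma simple_function_bounded_index:
  fixes j :: "'a \<Rightarrow> nat"
  assumes "j \<in> measurable M (count_space UNIV)" "\<And>\<omega>. j \<omega> \<le> n"
  shows "simple_function M (\<lambda>\<omega>. v (j \<omega>))"
proof (rule simple_function_compose1[where f = j])
  have "j ` space M \<subseteq> {..n}" using assms(2) by auto
  then have "finite (j ` space M)" by (rule finite_subset) simp
  then show "simple_function M j" using assms(1) by (simp add: simple_function_eq_measurable)
qed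

lemma simple_function_nearest_point:
  fixes X :: "'a \<Rightarrow> 'x::{metric_space, second_countable_topology}"
  assumes [measurable]: "X \<in> borel_measurable M"
  shows "simple_function M (\<lambda>\<omega>. nearest_point u n (X \<omega>))"
proof -
  \<comment> \<open>The minimum is replaced by finitely many comparisons of distances, from which
    measurability of the selected index is immediate.\<close>
  define j where "j \<omega> = (LEAST i. i \<le> n \<and> (\<forall>k\<in>{0..n}. dist (u i) (X \<omega>) \<le> dist (u k) (X \<omega>)))" for \<omega>
  have eq: "i \<le> n \<and> dist (u i) x = Min ((\<lambda>j. dist (u j) x) ` {0..n}) \<longleftrightarrow>
      i \<le> n \<and> (\<forall>k\<in>{0..n}. dist (u i) x \<le> dist (u k) x)" for i x
    by (auto simp: eq_commute[of "dist (u i) x"] Min_eq_iff)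
  have np: "nearest_point u n (X \<omega>) = u (j \<omega>)" for \<omega>
    unfolding nearest_point_def j_def eq ..
  have "j \<in> measurable M (count_space UNIV)" unfolding j_def by measurable
  moreover have "j \<omega> \<le> n" for \<omega>
  proof -
    let ?D = "(\<lambda>j. dist (u j) (X \<omega>)) ` {0..n}"
    have "Min ?D \<in> ?D" by (rule Min_in) auto
    then have "\<exists>i. i \<le> n \<and> dist (u i) (X \<omega>) = Min ?D" by force
    from LeastI_ex[OF this[unfolded eq]] show ?thesis by (simp add: j_def)
  qed
  ultimately show ?thesis unfolding np by (rule simple_function_bounded_index)
qed

text \<open>The points \<^term>\<open>\<phi> (nearest_point u n (X \<omega>))\<close> need not be dominated by an integrable function,
  so the values of the approximation are selected to control \<^term>\<open>\<phi>\<close> as well.\<close>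

lemma (in prob_space) simple_approximation:
  fixes X :: "'a \<Rightarrow> 'x::{metric_space, second_countable_topology}" and \<phi> :: "'x \<Rightarrow> real"
    and u :: "nat \<Rightarrow> 'x"
  assumes X [measurable]: "X \<in> borel_measurable M"
    and dense: "closure (range u) = UNIV"
    and cont: "continuous_on UNIV \<phi>"
    and intX: "integrable M (\<lambda>\<omega>. dist (u 0) (X \<omega>))" and int\<phi>: "integrable M (\<lambda>\<omega>. \<phi> (X \<omega>))"
    and \<epsilon>: "\<epsilon> > 0"
  obtains Z where "simple_function M Z"
    "integrable M (\<lambda>\<omega>. dist (Z \<omega>) (X \<omega>) + \<bar>\<phi> (Z \<omega>) - \<phi> (X \<omega>)\<bar>)"
    "(\<integral>\<omega>. dist (Z \<omega>) (X \<omega>) + \<bar>\<phi> (Z \<omega>) - \<phi> (X \<omega>)\<bar> \<partial>M) \<le> \<epsilon>"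
proof -
  have \<phi> [measurable]: "\<phi> \<in> borel_measurable borel"
    using cont by (rule borel_measurable_continuous_onI)
  define d where "d i \<omega> = dist (u i) (X \<omega>) + \<bar>\<phi> (u i) - \<phi> (X \<omega>)\<bar>" for i \<omega>
  have [measurable]: "d i \<in> borel_measurable M" for i unfolding d_def by measurable
  have ex: "\<exists>i. d i \<omega> < \<epsilon> / 2" for \<omega>
  proof -
    let ?f = "\<lambda>x. dist x (X \<omega>) + \<bar>\<phi> x - \<phi> (X \<omega>)\<bar>"
    have "continuous_on UNIV ?f" by (intro continuous_intros cont)
    \<comment> \<open>By continuity of \<open>\<phi>\<close> this is an open neighbourhood of
      \<open>X \<omega>\<close>, so it meets the dense range of \<open>u\<close>.\<close>
    then have "open {x. ?f x < \<epsilon> / 2}" by (rule open_Collect_less) (rule continuous_on_const)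
    moreover have "X \<omega> \<in> {x. ?f x < \<epsilon> / 2}" using \<epsilon> by simp
    ultimately have "{x. ?f x < \<epsilon> / 2} \<inter> range u \<noteq> {}"
      using open_Int_closure_eq_empty[of "{x. ?f x < \<epsilon> / 2}" "range u"] unfolding dense by blast
    then show ?thesis by (auto simp: d_def)
  qed
  define j where "j \<omega> = (LEAST i. d i \<omega> < \<epsilon> / 2)" for \<omega>
  have j [measurable]: "j \<in> measurable M (count_space UNIV)" unfolding j_def by measurable
  have dj: "d (j \<omega>) \<omega> < \<epsilon> / 2" for \<omega> unfolding j_def by (rule LeastI_ex[OF ex])
  \<comment> \<open>Truncation at \<open>m\<close> leaves finitely many values. The fallback is
    index 0 because the error \<open>d 0\<close> is integrable.\<close>
  define k where "k m \<omega> = (if j \<omega> \<le> m then j \<omega> else 0)" for m \<omega>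
  have k [measurable]: "k m \<in> measurable M (count_space UNIV)" for m unfolding k_def by measurable
  \<comment> \<open>The error caused by the fallback: it is dominated by \<open>d 0\<close> and
    vanishes once \<open>m\<close> reaches \<open>j \<omega>\<close>, so its integral tends to 0.
    The other half of \<open>\<epsilon>\<close> bounds the error where no truncation occurs.\<close>
  define t where "t m \<omega> = (if j \<omega> \<le> m then 0 else d 0 \<omega>)" for m \<omega>
  have [measurable]: "t m \<in> borel_measurable M" for m unfolding t_def by measurable
  have int0: "integrable M (d 0)" unfolding d_def by (intro Bochner_Integration.integrable_add
      integrable_abs Bochner_Integration.integrable_diff intX int\<phi>) auto
  have d0: "0 \<le> d i \<omega>" for i \<omega> by (simp add: d_def)
  have tint: "integrable M (t m)" for m
    by (rule Bochner_Integration.integrable_bound[OF int0]) (use d0 in \<open>auto simp: t_def\<close>)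
  have "(\<lambda>m. \<integral>\<omega>. t m \<omega> \<partial>M) \<longlonglongrightarrow> (\<integral>\<omega>. 0 \<partial>M)"
  proof (rule integral_dominated_convergence[where w = "d 0"])
    show "AE \<omega> in M. (\<lambda>m. t m \<omega>) \<longlonglongrightarrow> 0"
    proof (rule AE_I2)
      fix \<omega>
      have "\<forall>\<^sub>F m in sequentially. t m \<omega> = 0"
        using eventually_ge_at_top[of "j \<omega>"] by eventually_elim (simp add: t_def)
      then show "(\<lambda>m. t m \<omega>) \<longlonglongrightarrow> 0" by (rule tendsto_eventually)
    qed
    show "AE \<omega> in M. norm (t m \<omega>) \<le> d 0 \<omega>" for m using d0 by (auto simp: t_def)
  qed (use int0 in auto)
  then have "(\<lambda>m. \<integral>\<omega>. t m \<omega> \<partial>M) \<longlonglongrightarrow> 0" by simp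
  from order_tendstoD(2)[OF this, of "\<epsilon> / 2"] \<epsilon>
  obtain m where m: "(\<integral>\<omega>. t m \<omega> \<partial>M) < \<epsilon> / 2" by (auto simp: eventually_sequentially)
  have le: "d (k m \<omega>) \<omega> \<le> \<epsilon> / 2 + t m \<omega>" for \<omega>
    using dj[of \<omega>] \<epsilon> by (auto simp: k_def t_def)
  have int: "integrable M (\<lambda>\<omega>. d (k m \<omega>) \<omega>)"
  proof (rule Bochner_Integration.integrable_bound)
    show "integrable M (\<lambda>\<omega>. \<epsilon> / 2 + t m \<omega>)" using tint by simp
    show "(\<lambda>\<omega>. d (k m \<omega>) \<omega>) \<in> borel_measurable M"
      by measurable
    show "AE \<omega> in M. norm (d (k m \<omega>) \<omega>) \<le> norm (\<epsilon> / 2 + t m \<omega>)"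
      using le d0 by (auto intro!: AE_I2 order_trans[OF _ abs_ge_self])
  qed
  have "(\<integral>\<omega>. d (k m \<omega>) \<omega> \<partial>M) \<le> (\<integral>\<omega>. \<epsilon> / 2 + t m \<omega> \<partial>M)"
    using int tint le by (intro integral_mono) auto
  also have "\<dots> = \<epsilon> / 2 + (\<integral>\<omega>. t m \<omega> \<partial>M)"
    using tint by (simp add: prob_space)
  finally have "(\<integral>\<omega>. d (k m \<omega>) \<omega> \<partial>M) \<le> \<epsilon>" using m by simp
  moreover have "simple_function M (\<lambda>\<omega>. u (k m \<omega>))"
    by (rule simple_function_bounded_index[OF k, of _ m]) (simp add: k_def)
  ultimately show ?thesis using int unfolding d_def by (intro that)
qed

section \<open>Passage to the limit in Jensen's inequality\<close>

theorem proposition4p11: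
  fixes cc :: "(real \<times> 'x::polish_space) list \<Rightarrow> 'x"
    and u :: "nat \<Rightarrow> 'x"
    and \<phi> :: "'x \<Rightarrow> real"
    and M G :: "'a measure"
    and X :: "'a \<Rightarrow> 'x"
  assumes "cc_space cc"
    and "approximating_sequence cc u"
    and "prob_space M"
    and "complete_measure M"
    and "atomless M"
    and "subalgebra M G"
    and "midpoint_convex cc \<phi>"
    and "continuous_on UNIV \<phi>"
    and "integrable_element M X"
    and "integrable M (\<lambda>\<omega>. \<phi> (X \<omega>))"
  shows "AE \<omega> in M. \<phi> (cc_cond_exp cc u M G X \<omega>) \<le> real_cond_exp M G (\<lambda>\<omega>'. \<phi> (X \<omega>')) \<omega>"
proof -
  note cc = assms(1) and prob = assms(3) and sub = assms(6) and mid = assms(7) and cont = assms(8)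
    and int\<phi> = assms(10)
  interpret prob_space M by (rule prob)
  interpret finite_measure_subalgebra M G by unfold_locales (rule sub)
  have X [measurable]: "X \<in> borel_measurable M"
    using assms(9) by (simp add: integrable_element_def)
  have \<phi> [measurable]: "\<phi> \<in> borel_measurable borel"
    using cont by (rule borel_measurable_continuous_onI)
  have "closure (u ` {1..}) \<subseteq> closure (range u)" by (intro closure_mono) auto
  then have dense: "closure (range u) = UNIV"
    using assms(2) by (auto simp: approximating_sequence_def)
  have intX: "integrable M (\<lambda>\<omega>. dist z (X \<omega>))" for z
  proof -
    obtain v where v: "integrable M (\<lambda>\<omega>. dist v (X \<omega>))"
      using assms(9) by (auto simp: integrable_element_def)
    show ?thesis
    proof (rule Bochner_Integration.integrable_bound)
      show "integrable M (\<lambda>\<omega>. dist z v + dist v (X \<omega>))" using v by simp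
      show "AE \<omega> in M. norm (dist z (X \<omega>)) \<le> norm (dist z v + dist v (X \<omega>))"
        using dist_triangle[of z _ v] by auto
    qed measurable
  qed

  define Y where "Y n \<omega> = nearest_point u n (X \<omega>)" for n \<omega>
  have Y: "simple_function M (Y n)" for n
    unfolding Y_def by (rule simple_function_nearest_point[OF X])
  note Y_meas [measurable] = borel_measurable_simple_function[OF Y]
  \<comment> \<open>The point \<open>u 0\<close> is a candidate for every \<open>n\<close>, so its
    distance to \<open>X\<close> dominates all errors.\<close>
  have Y_le: "dist (Y n \<omega>) (X \<omega>) \<le> dist (u 0) (X \<omega>)" for n \<omega>
    unfolding Y_def by (rule dist_nearest_point_le) simp
  have intY: "integrable M (\<lambda>\<omega>. dist (Y n \<omega>) (X \<omega>))" for n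
    by (rule Bochner_Integration.integrable_bound[OF intX[of "u 0"]]) (use Y_le in auto)
  have Y_lim: "(\<lambda>n. dist (Y n \<omega>) (X \<omega>)) \<longlonglongrightarrow> 0" for \<omega>
    unfolding Y_def by (rule dist_nearest_point_tendsto_0[OF dense])
  have "(\<lambda>n. \<integral>\<omega>. dist (Y n \<omega>) (X \<omega>) \<partial>M) \<longlonglongrightarrow> (\<integral>\<omega>. 0 \<partial>M)"
    by (rule integral_dominated_convergence[OF _ _ intX[of "u 0"]])
      (use Y_le Y_lim in auto)
  then have Y0: "AE \<omega> in M. (\<lambda>n. real_cond_exp M G (\<lambda>\<omega>. dist (Y n \<omega>) (X \<omega>)) \<omega>) \<longlonglongrightarrow> 0"
    by (intro AE_cond_exp_decseq_tendsto_0[OF prob sub] intY)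
      (auto simp: Y_def dist_nearest_point_Suc_le)

  define W where "W Z \<omega> = dist (Z \<omega>) (X \<omega>) + \<bar>\<phi> (Z \<omega>) - \<phi> (X \<omega>)\<bar>" for Z \<omega>
  have "\<exists>Z. simple_function M Z \<and> integrable M (W Z) \<and> (\<integral>\<omega>. W Z \<omega> \<partial>M) \<le> 1 / real (Suc k)" for k
    by (rule simple_approximation[OF X dense cont intX int\<phi>, of "1 / real (Suc k)"])
      (auto simp: W_def[abs_def])
  then obtain Z where Z: "\<And>k. simple_function M (Z k)" and intW: "\<And>k. integrable M (W (Z k))"
    and Wle: "\<And>k. (\<integral>\<omega>. W (Z k) \<omega> \<partial>M) \<le> 1 / real (Suc k)" by metis
  note Z_meas [measurable] = borel_measurable_simple_function[OF Z]
  have W_nonneg: "0 \<le> W (Z k) \<omega>" for k \<omega> by (simp add: W_def)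
  have W_lim: "(\<lambda>k. \<integral>\<omega>. W (Z k) \<omega> \<partial>M) \<longlonglongrightarrow> 0"
    by (rule tendsto_sandwich[OF _ _ tendsto_const LIMSEQ_Suc[OF lim_1_over_n]])
      (use Wle in \<open>auto simp: W_def intro!: always_eventually integral_nonneg\<close>)
  \<comment> \<open>The errors \<open>W (Z k)\<close> need not be monotone in \<open>k\<close>, so
    almost sure convergence is obtained only along a subsequence.\<close>
  obtain r where "strict_mono r"
    and W0: "AE \<omega> in M. (\<lambda>k. real_cond_exp M G (W (Z (r k))) \<omega>) \<longlonglongrightarrow> 0"
    by (rule AE_cond_exp_tendsto_0_subseq[OF prob sub intW W_nonneg W_lim])

  let ?E = "simple_cond_exp cc M G"
  \<comment> \<open>Majorants \<open>f\<close> and \<open>g\<close> of the distances allow the exact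
    distance to be used for \<open>Y\<close> and the larger \<open>W\<close> for
    \<open>Z\<close>.\<close>
  have tri: "AE \<omega> in M. dist (?E S \<omega>) (?E T \<omega>) \<le> real_cond_exp M G f \<omega> + real_cond_exp M G g \<omega>"
    if S: "simple_function M S" and T: "simple_function M T"
      and f: "integrable M f" and g: "integrable M g"
      and "\<And>\<omega>. dist (S \<omega>) (X \<omega>) \<le> f \<omega>" "\<And>\<omega>. dist (T \<omega>) (X \<omega>) \<le> g \<omega>" for S T f g
  proof -
    have [measurable]: "S \<in> borel_measurable M" "T \<in> borel_measurable M"
      using S T by (auto intro: borel_measurable_simple_function)
    have fg: "integrable M (\<lambda>\<omega>. f \<omega> + g \<omega>)" using f g by simp
    have le: "dist (S \<omega>) (T \<omega>) \<le> f \<omega> + g \<omega>" for \<omega>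
      using that(5,6)[of \<omega>] dist_triangle2[of "S \<omega>" "T \<omega>" "X \<omega>"] by linarith
    have "integrable M (\<lambda>\<omega>. dist (S \<omega>) (T \<omega>))"
      by (rule Bochner_Integration.integrable_bound[OF fg])
        (use le in \<open>auto intro!: AE_I2 order_trans[OF _ abs_ge_self]\<close>)
    then have "AE \<omega> in M. real_cond_exp M G (\<lambda>\<omega>. dist (S \<omega>) (T \<omega>)) \<omega> \<le>
        real_cond_exp M G (\<lambda>\<omega>. f \<omega> + g \<omega>) \<omega>"
      using fg le by (intro real_cond_exp_mono) auto
    moreover note AE_dist_simple_cond_exp_le[OF prob sub cc S T] real_cond_exp_add[OF f g]
    ultimately show ?thesis by eventually_elim simp
  qed
  have YY: "AE \<omega> in M. \<forall>n m. dist (?E (Y n) \<omega>) (?E (Y m) \<omega>) \<le>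
      real_cond_exp M G (\<lambda>\<omega>. dist (Y n \<omega>) (X \<omega>)) \<omega> + real_cond_exp M G (\<lambda>\<omega>. dist (Y m \<omega>) (X \<omega>)) \<omega>"
    unfolding AE_all_countable by (intro allI tri Y intY order_refl)
  have YZ: "AE \<omega> in M. \<forall>n. dist (?E (Y n) \<omega>) (?E (Z (r n)) \<omega>) \<le>
      real_cond_exp M G (\<lambda>\<omega>. dist (Y n \<omega>) (X \<omega>)) \<omega> + real_cond_exp M G (W (Z (r n))) \<omega>"
    unfolding AE_all_countable by (intro allI tri Y Z intY intW) (auto simp: W_def)
  \<comment> \<open>Jensen for the simple \<open>Z (r n)\<close> is combined with
    \<open>\<phi> (Z) \<le> \<phi> (X) + W\<close>, leaving an error that vanishes along
    \<open>r\<close>.\<close>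
  have Z_jensen: "AE \<omega> in M. \<forall>n. \<phi> (?E (Z (r n)) \<omega>) \<le>
      real_cond_exp M G (\<lambda>\<omega>. \<phi> (X \<omega>)) \<omega> + real_cond_exp M G (W (Z (r n))) \<omega>"
    unfolding AE_all_countable
  proof
    fix n
    let ?Z = "Z (r n)"
    have sum: "integrable M (\<lambda>\<omega>. \<phi> (X \<omega>) + W ?Z \<omega>)" using int\<phi> intW by simp
    have bd: "integrable M (\<lambda>\<omega>. \<bar>\<phi> (X \<omega>)\<bar> + W ?Z \<omega>)" using int\<phi> intW by simp
    have "\<bar>\<phi> (?Z \<omega>)\<bar> \<le> \<bar>\<phi> (X \<omega>)\<bar> + W ?Z \<omega>" for \<omega>
      using zero_le_dist[of "?Z \<omega>" "X \<omega>"] unfolding W_def by linarith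
    then have "integrable M (\<lambda>\<omega>. \<phi> (?Z \<omega>))"
      by (intro Bochner_Integration.integrable_bound[OF bd])
        (auto intro!: AE_I2 order_trans[OF _ abs_ge_self])
    moreover have "\<phi> (?Z \<omega>) \<le> \<phi> (X \<omega>) + W ?Z \<omega>" for \<omega>
      using zero_le_dist[of "?Z \<omega>" "X \<omega>"] unfolding W_def by linarith
    ultimately have "AE \<omega> in M. real_cond_exp M G (\<lambda>\<omega>. \<phi> (?Z \<omega>)) \<omega> \<le>
        real_cond_exp M G (\<lambda>\<omega>. \<phi> (X \<omega>) + W ?Z \<omega>) \<omega>"
      using sum by (intro real_cond_exp_mono) auto
    moreover note AE_simple_cond_exp_jensen[OF prob sub cc Z mid cont, of "r n"]
      real_cond_exp_add[OF int\<phi> intW, of "r n"]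
    ultimately show "AE \<omega> in M. \<phi> (?E ?Z \<omega>) \<le>
        real_cond_exp M G (\<lambda>\<omega>. \<phi> (X \<omega>)) \<omega> + real_cond_exp M G (W ?Z) \<omega>"
      by eventually_elim simp
  qed

  from Y0 W0 YY YZ Z_jensen show ?thesis
  proof eventually_elim
    case (elim \<omega>)
    define a where "a n = real_cond_exp M G (\<lambda>\<omega>. dist (Y n \<omega>) (X \<omega>)) \<omega>" for n
    define b where "b n = real_cond_exp M G (W (Z (r n))) \<omega>" for n
    have a: "a \<longlonglongrightarrow> 0" and b: "b \<longlonglongrightarrow> 0"
      using elim(1,2) by (simp_all add: a_def[abs_def] b_def[abs_def])
    have "Cauchy (\<lambda>n. ?E (Y n) \<omega>)"
    proof (rule metric_CauchyI)
      fix e :: real assume "e > 0"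
      then obtain N where N: "\<And>n. n \<ge> N \<Longrightarrow> \<bar>a n\<bar> < e / 2"
        using metric_LIMSEQ_D[OF a, of "e / 2"] by (auto simp: dist_real_def)
      have "dist (?E (Y m) \<omega>) (?E (Y n) \<omega>) < e" if "m \<ge> N" "n \<ge> N" for m n
      proof -
        have "dist (?E (Y m) \<omega>) (?E (Y n) \<omega>) \<le> a m + a n" using elim by (simp add: a_def)
        then show ?thesis using N[OF that(1)] N[OF that(2)] by linarith
      qed
      then show "\<exists>N. \<forall>m\<ge>N. \<forall>n\<ge>N. dist (?E (Y m) \<omega>) (?E (Y n) \<omega>) < e" by blast
    qed
    \<comment> \<open>Completeness shows that the limit defining \<open>cc_cond_exp\<close> exists
      at this \<open>\<omega>\<close>, so \<open>lim\<close> returns its actual value.\<close>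
    then obtain L where L: "(\<lambda>n. ?E (Y n) \<omega>) \<longlonglongrightarrow> L"
      using Cauchy_convergent convergent_def by blast
    then have L_eq: "cc_cond_exp cc u M G X \<omega> = L"
      by (simp add: cc_cond_exp_def Y_def[abs_def] limI)
    have "(\<lambda>n. dist (?E (Y n) \<omega>) L + (a n + b n)) \<longlonglongrightarrow> dist L L + (0 + 0)"
      by (intro tendsto_intros L a b)
    \<comment> \<open>Comparison with \<open>?E (Y n)\<close> at the same index transfers the limit
      to the sequence for which Jensen is available.\<close>
    moreover have "dist (?E (Z (r n)) \<omega>) L \<le> dist (?E (Y n) \<omega>) L + (a n + b n)" for n
    proof -
      have "dist (?E (Y n) \<omega>) (?E (Z (r n)) \<omega>) \<le> a n + b n" using elim by (simp add: a_def b_def)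
      then show ?thesis using dist_triangle3[of "?E (Z (r n)) \<omega>" L "?E (Y n) \<omega>"] by linarith
    qed
    ultimately have "(\<lambda>n. ?E (Z (r n)) \<omega>) \<longlonglongrightarrow> L"
      by (elim metric_tendsto_imp_tendsto)
        (auto simp: dist_real_def intro!: always_eventually order_trans[OF _ abs_ge_self])
    then have "(\<lambda>n. \<phi> (?E (Z (r n)) \<omega>)) \<longlonglongrightarrow> \<phi> L"
      by (rule continuous_on_tendsto_compose[OF cont]) auto
    moreover have "(\<lambda>n. real_cond_exp M G (\<lambda>\<omega>. \<phi> (X \<omega>)) \<omega> + b n) \<longlonglongrightarrow>
        real_cond_exp M G (\<lambda>\<omega>. \<phi> (X \<omega>)) \<omega> + 0"
      by (intro tendsto_intros b)
    ultimately have "\<phi> L \<le> real_cond_exp M G (\<lambda>\<omega>. \<phi> (X \<omega>)) \<omega> + 0"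
      by (rule LIMSEQ_le) (use elim in \<open>auto simp: b_def\<close>)
    then show ?case unfolding L_eq by simp
  qed
qed

end
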